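(* Let $F_1,\ldots,F_l$ be vector fields on $\mathbb{R}^n$ that are smooth and bounded together with their derivatives of each order, let $\mathcal{U}=L^2([0,1],\mathbb{R}^l)$, and let $K\subset\mathbb{R}^n$ be compact. Given $\Psi\in\mathrm{Diff}^0_K(\mathbb{R}^n)\setminus\mathrm{Flows}_K(F_1,\ldots,F_l)$ and a sequence $(\Phi_{u_\ell})_{\ell\ge1}\subset\mathrm{Flows}_K(F_1,\ldots,F_l)$, with $u_\ell\in\mathcal{U}$, such that $\Phi_{u_\ell}\to\Psi$ uniformly on $K$ as $\ell\to\infty$, the sequence of controls $(u_\ell)_{\ell\ge1}\subset\mathcal{U}$ is unbounded in the $L^2$-norm.
   Context: For $u\in\mathcal{U}$ and $x_0\in\mathbb{R}^n$, let $x_{u,x_0}:[0,1]\to\mathbb{R}^n$ be the unique (Carath\'eodory) solution of $\dot x(s)=\sum_{i=1}^l F_i(x(s))u_i(s)$, $x(0)=x_0$; the flow is $\Phi_u:\mathbb{R}^n\to\mathbb{R}^n$, $\Phi_u(x_0):=x_{u,x_0}(1)$. $\mathrm{Flows}_K(F_1,\ldots,F_l)$ is the set of restrictions to $K$ of the flows $\Phi_u$, $u\in\mathcal{U}$. $\mathrm{Diff}^0_K(\mathbb{R}^n)$ is the set of restrictions to $K$ of diffeomorphisms of $\mathbb{R}^n$ diffeotopic to the identity, where $\Psi$ is diffeotopic to the identity if there is a family of diffeomorphisms $(\Psi_s)_{s\in[0,1]}$ of $\mathbb{R}^n$ depending smoothly on $s$ with $\Psi_0=\mathrm{Id}$, $\Psi_1=\Psi$.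 *)

theory Defs
  imports "HOL-Analysis.Analysis"
begin

(* Iterated derivatives within S, in the directions vs. Where S is open, or is the closed slab
   {0..1} \<times> UNIV, derivatives within S are unique, so frechet_derivative is the derivative. *)
primrec iter_deriv ::
  "'a::real_normed_vector set \<Rightarrow> ('a \<Rightarrow> 'b::real_normed_vector) \<Rightarrow> 'a list \<Rightarrow> 'a \<Rightarrow> 'b" where
  "iter_deriv S f [] = f"
| "iter_deriv S f (v # vs) = (\<lambda>x. frechet_derivative (iter_deriv S f vs) (at x within S) v)"

definition smooth_on ::
  "'a::euclidean_space set \<Rightarrow> ('a \<Rightarrow> 'b::euclidean_space) \<Rightarrow> bool" where
  "smooth_on S f \<longleftrightarrow> (\<forall>vs. iter_deriv S f vs differentiable_on S)"

(* In finite dimension, the k-th derivative is bounded in operator norm iff its values in each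
   fixed list of k directions are bounded. The empty list gives boundedness of f itself. *)
definition smooth_bounded :: "('a::euclidean_space \<Rightarrow> 'b::euclidean_space) \<Rightarrow> bool" where
  "smooth_bounded f \<longleftrightarrow> smooth_on UNIV f \<and> (\<forall>vs. bounded (range (iter_deriv UNIV f vs)))"

(* Square-integrable representatives; elements of L2([0,1]) are their classes modulo equality
   almost everywhere in {0..1}. *)
definition L2_controls :: "(real \<Rightarrow> 'a::euclidean_space) set" where
  "L2_controls = {u. u \<in> borel_measurable (lebesgue_on {0..1}) \<and>
     integrable (lebesgue_on {0..1}) (\<lambda>s. (norm (u s))\<^sup>2)}"

definition L2_control_norm :: "(real \<Rightarrow> 'a::euclidean_space) \<Rightarrow> real" where
  "L2_control_norm u = sqrt (\<integral>s. (norm (u s))\<^sup>2 \<partial>lebesgue_on {0..1})"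

(* The finite families of non-overlapping compact intervals are the divisions D of their union. *)
definition abs_continuous_on :: "real set \<Rightarrow> (real \<Rightarrow> 'a::metric_space) \<Rightarrow> bool" where
  "abs_continuous_on S f \<longleftrightarrow>
     (\<forall>\<epsilon>>0. \<exists>\<delta>>0. \<forall>D T. D division_of T \<longrightarrow> T \<subseteq> S \<longrightarrow> (\<Sum>I\<in>D. measure lborel I) < \<delta> \<longrightarrow>
        (\<Sum>I\<in>D. dist (f (Inf I)) (f (Sup I))) < \<epsilon>)"

definition caratheodory_solution ::
  "('l::finite \<Rightarrow> real^'n \<Rightarrow> real^'n) \<Rightarrow> (real \<Rightarrow> real^'l) \<Rightarrow> real^'n \<Rightarrow> (real \<Rightarrow> real^'n) \<Rightarrow> bool" where
  "caratheodory_solution F u x0 x \<longleftrightarrow>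
     abs_continuous_on {0..1} x \<and> x 0 = x0 \<and>
     (AE s in lebesgue_on {0..1}.
        (x has_vector_derivative (\<Sum>i\<in>UNIV. u s $ i *\<^sub>R F i (x s))) (at s within {0..1}))"

(* A curve on [0,1] is a function that is undefined outside {0..1}, so that uniqueness on [0,1]
   is uniqueness as a HOL function. *)
definition trajectory ::
  "('l::finite \<Rightarrow> real^'n \<Rightarrow> real^'n) \<Rightarrow> (real \<Rightarrow> real^'l) \<Rightarrow> real^'n \<Rightarrow> real \<Rightarrow> real^'n" where
  "trajectory F u x0 = (THE x. x \<in> extensional {0..1} \<and> caratheodory_solution F u x0 x)"

definition flow ::
  "('l::finite \<Rightarrow> real^'n \<Rightarrow> real^'n) \<Rightarrow> (real \<Rightarrow> real^'l) \<Rightarrow> real^'n \<Rightarrow> real^'n" where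
  "flow F u x0 = trajectory F u x0 1"

definition flows_on ::
  "(real^'n) set \<Rightarrow> ('l::finite \<Rightarrow> real^'n \<Rightarrow> real^'n) \<Rightarrow> (real^'n \<Rightarrow> real^'n) set" where
  "flows_on K F = {restrict (flow F u) K | u. u \<in> L2_controls}"

definition diffeomorphism :: "('a::euclidean_space \<Rightarrow> 'a) \<Rightarrow> bool" where
  "diffeomorphism f \<longleftrightarrow> bij f \<and> smooth_on UNIV f \<and> smooth_on UNIV (inv f)"

(* Smooth dependence on s is joint smoothness in (s, x) on [0,1] \<times> R^n, with one-sided
   derivatives in s at the two ends. *)
definition diffeotopic_to_id :: "('a::euclidean_space \<Rightarrow> 'a) \<Rightarrow> bool" where
  "diffeotopic_to_id \<Psi> \<longleftrightarrow>
     (\<exists>H :: real \<Rightarrow> 'a \<Rightarrow> 'a.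
        (\<forall>s\<in>{0..1}. diffeomorphism (H s)) \<and>
        smooth_on ({0..1} \<times> UNIV) (\<lambda>(s, x). H s x) \<and>
        H 0 = id \<and> H 1 = \<Psi>)"

definition Diff0_on :: "'a::euclidean_space set \<Rightarrow> ('a \<Rightarrow> 'a) set" where
  "Diff0_on K = {restrict \<Psi> K | \<Psi>. diffeomorphism \<Psi> \<and> diffeotopic_to_id \<Psi>}"

end

theory Submission
  imports Defs "HOL-Complex_Analysis.Great_Picard"
begin

text \<open>
  On bounded sets of controls the flow is continuous for weak convergence in \<open>L\<^sup>2\<close>, and bounded
  sets are weakly sequentially compact. So if the controls were bounded, a subsequence would
  converge weakly to some control \<open>v\<close>, its flows would converge pointwise to the flow of \<open>v\<close>, and
  \<open>\<Psi>\<close>, being the limit of these flows on \<open>K\<close>, would be the flow of \<open>v\<close> on \<open>K\<close>. This contradicts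
  the choice of \<open>\<Psi>\<close>.

  Weak convergence of bounded controls is expressed as uniform convergence of their primitives
  \<open>\<integral>\<^sub>0\<^sup>t u\<close>. By the Cauchy-Schwarz inequality the primitives of a bounded family are equi-Hoelder of
  exponent \<open>1/2\<close>, so Arzela-Ascoli gives a uniformly convergent subsequence. The limit \<open>U\<close> is again
  the primitive of an \<open>L\<^sup>2\<close> control: the controls whose primitive is uniformly close to \<open>U\<close> form
  convex sets that shrink with the tolerance, and by the parallelogram law almost minimal elements
  of these sets form a Cauchy sequence in \<open>L\<^sup>2\<close>, whose limit has primitive \<open>U\<close>
  (\<open>L2_bounded_controls_weakly_compact\<close>).

  For the flow, let \<open>x\<^sub>k\<close> and \<open>y\<close> be the trajectories of \<open>u\<^sub>k\<close> and of the weak limit \<open>v\<close> from the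
  same point. Then \<open>x\<^sub>k - y\<close> satisfies a Gronwall inequality with kernel \<open>|u\<^sub>k|\<close>, whose forcing term
  is \<open>\<integral>\<^sub>0\<^sup>t \<Sum>\<^sub>i (u\<^sub>k - v)\<^sub>i F\<^sub>i(y)\<close>. There \<open>y\<close> is a fixed continuous curve, so the term tends to zero
  uniformly in \<open>t\<close> after \<open>y\<close> is approximated by step functions (\<open>velocity_integral_weak_limit\<close>,
  \<open>integral_solution_stable\<close>, \<open>flow_weakly_continuous\<close>).

  The flow is given by Caratheodory solutions: absolutely continuous curves that satisfy the
  equation almost everywhere. These are the continuous solutions of the integral equation. One
  direction is the fundamental theorem of calculus for absolutely continuous functions, the other
  is Lebesgue's differentiation theorem for indefinite integrals; both follow from gauge integration.
  The integral equation is uniquely solvable by Picard iteration in an exponentially weighted norm.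
\<close>

section \<open>Absolutely continuous functions and indefinite integrals\<close>

lemma AE_lebesgue_on_iff_negligible:
  assumes "S \<in> sets lebesgue"
  shows "(AE s in lebesgue_on S. P s) \<longleftrightarrow> negligible {s \<in> S. \<not> P s}"
proof -
  have "(AE s in lebesgue_on S. P s) \<longleftrightarrow> (AE s in lebesgue. s \<in> S \<longrightarrow> P s)"
    using assms by (simp add: AE_restrict_space_iff)
  also have "\<dots> \<longleftrightarrow> {s \<in> S. \<not> P s} \<in> null_sets lebesgue"
  proof
    assume "AE s in lebesgue. s \<in> S \<longrightarrow> P s"
    then obtain N where N: "\<And>s. s \<in> space lebesgue - N \<Longrightarrow> s \<in> S \<longrightarrow> P s" "N \<in> null_sets lebesgue"
      by (elim AE_E3) blast
    show "{s \<in> S. \<not> P s} \<in> null_sets lebesgue"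
      unfolding negligible_iff_null_sets[symmetric]
      by (rule negligible_subset[of N]) (use N in \<open>auto simp: negligible_iff_null_sets\<close>)
  next
    assume "{s \<in> S. \<not> P s} \<in> null_sets lebesgue"
    then show "AE s in lebesgue. s \<in> S \<longrightarrow> P s"
      by (rule AE_I') auto
  qed
  finally show ?thesis by (simp add: negligible_iff_null_sets)
qed

lemma abs_continuous_on_subset:
  assumes "abs_continuous_on S f" "T \<subseteq> S"
  shows "abs_continuous_on T f"
  using assms unfolding abs_continuous_on_def by (meson order_trans)

text \<open>
  The derivative is integrable in the gauge sense and recovers the function. At points of
  differentiability the gauge forces the Riemann sums to follow the increments of \<open>f\<close>. The
  exceptional null set is covered by an open set of small measure, and absolute continuity bounds
  the total increment over the tagged intervals inside it.
\<close>

lemma has_integral_abs_continuous: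
  fixes f g :: "real \<Rightarrow> 'a::banach"
  assumes ab: "a \<le> b" and ac: "abs_continuous_on {a..b} f" and N: "negligible N"
    and der: "\<And>s. s \<in> {a..b} - N \<Longrightarrow> (f has_vector_derivative g s) (at s within {a..b})"
  shows "(g has_integral (f b - f a)) {a..b}"
proof (rule has_integral_spike[OF N])
  define h where "h = (\<lambda>s. if s \<in> N then 0 else g s)"
  show "g s = h s" if "s \<in> {a..b} - N" for s
    using that by (simp add: h_def)
  show "(h has_integral (f b - f a)) {a..b}"
    unfolding has_integral_real
  proof (intro allI impI)
    fix e :: real
    assume e: "e > 0"
    \<comment> \<open>The slack \<open>+ 1\<close> covers the degenerate interval.\<close>
    define c where "c = e / (2 * (b - a + 1))"
    have c: "c > 0" using e ab by (simp add: c_def)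
    obtain \<delta> where \<delta>: "\<delta> > 0" and ac\<delta>: "\<And>D T. \<lbrakk>D division_of T; T \<subseteq> {a..b}; (\<Sum>I\<in>D. measure lborel I) < \<delta>\<rbrakk>
          \<Longrightarrow> (\<Sum>I\<in>D. dist (f (Inf I)) (f (Sup I))) < e/2"
      using ac e unfolding abs_continuous_on_def by (metis half_gt_zero)
    have N0: "N \<in> null_sets lebesgue" using N negligible_iff_null_sets by blast
    obtain G where G: "open G" "N \<subseteq> G" "(G - N) \<in> lmeasurable" "emeasure lebesgue (G - N) < ennreal \<delta>"
      using sets_lebesgue_outer_open[of N \<delta>] N0 \<delta> by (auto simp: null_sets_def)
    have GN: "emeasure lebesgue G < ennreal \<delta>"
      using G N0 by (simp add: emeasure_Diff_null_set borel_open)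
    have Gm: "G \<in> lmeasurable"
      using GN G(1) by (auto simp: fmeasurable_def borel_open less_top[symmetric] intro: less_trans)
    have mG: "measure lebesgue G < \<delta>"
      using GN Gm by (simp add: emeasure_eq_measure2 ennreal_less_iff)
    have "\<forall>x. \<exists>d>0. x \<in> {a..b} - N \<longrightarrow>
         (\<forall>y\<in>{a..b}. norm (y-x) < d \<longrightarrow> norm (f y - f x - (y-x) *\<^sub>R g x) \<le> c * norm (y-x))"
      using der[unfolded has_vector_derivative_def has_derivative_within_alt] c by (metis zero_less_one)
    then obtain d where d: "\<And>x. 0 < d x"
      "\<And>x y. \<lbrakk>x \<in> {a..b} - N; y \<in> {a..b}; norm (y-x) < d x\<rbrakk>
                        \<Longrightarrow> norm (f y - f x - (y-x) *\<^sub>R g x) \<le> c * norm (y-x)"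
      by metis
    define \<gamma> where "\<gamma> = (\<lambda>x. if x \<in> N then G else ball x (d x))"
    have gauge: "gauge \<gamma>"
      using G d(1) by (auto simp: gauge_def \<gamma>_def)
    have fine_sum: "norm ((\<Sum>(x,K)\<in>p. measure lborel K *\<^sub>R h x) - (f b - f a)) < e"
      if p: "p tagged_division_of {a..b}" and fine: "\<gamma> fine p" for p
    proof -
      define q where "q = {(x,K). (x,K) \<in> p \<and> x \<in> N}"
      define r where "r = p - q"
      have fin: "finite p" using p by blast
      have qp: "q \<subseteq> p" "r \<subseteq> p" and prq: "p = q \<union> r" "q \<inter> r = {}" by (auto simp: q_def r_def)
      have ivl: "\<exists>u v. K = {u..v} \<and> u \<le> x \<and> x \<le> v \<and> a \<le> u \<and> v \<le> b" if "(x,K) \<in> p" for x K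
      proof -
        obtain u v where uv: "K = {u..v}" using p \<open>(x,K) \<in> p\<close> by (metis box_real(2) tagged_division_ofD(4))
        moreover have "x \<in> K" "K \<subseteq> {a..b}" using p that by blast+
        ultimately show ?thesis by auto
      qed
      have q_part: "q tagged_partial_division_of {a..b}"
        using p by (intro tagged_partial_division_subset[OF _ qp(1)]) (simp add: tagged_division_of_def)
      have divq: "snd ` q division_of \<Union>(snd ` q)"
        by (rule partial_division_of_tagged_division[OF q_part])
      have sub: "\<Union>(snd ` q) \<subseteq> {a..b} \<inter> G"
      proof -
        have "K \<subseteq> {a..b} \<inter> G" if "(x,K) \<in> q" for x K
        proof -
          have "(x,K) \<in> p" "x \<in> N" using that by (auto simp: q_def)
          then have "K \<subseteq> G" "K \<subseteq> {a..b}"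
            using fineD[OF fine, of x K] tagged_division_ofD(3)[OF p, of x K] by (auto simp: \<gamma>_def)
          then show ?thesis by simp
        qed
        then show ?thesis by fastforce
      qed
      have "measure lborel I = measure lebesgue I" if "I \<in> snd ` q" for I
        using division_ofD(4)[OF divq that] by auto
      then have "(\<Sum>I\<in>snd ` q. measure lborel I) = measure lebesgue (\<Union>(snd ` q))"
        using content_division[OF divq] by simp
      also have "\<dots> \<le> measure lebesgue G"
        using sub divq Gm by (intro measure_mono_fmeasurable) (auto intro: fmeasurableD lmeasurable_division)
      also have "\<dots> < \<delta>" by (rule mG)
      finally have "(\<Sum>I\<in>snd ` q. dist (f (Inf I)) (f (Sup I))) < e/2"
        using ac\<delta>[OF divq] sub by blast
      moreover have "(\<Sum>(x,K)\<in>q. dist (f (Inf K)) (f (Sup K))) = (\<Sum>I\<in>snd ` q. dist (f (Inf I)) (f (Sup I)))"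
      proof -
        \<comment> \<open>The summation lemma needs the value zero on empty boxes, where \<open>Inf\<close> and \<open>Sup\<close> are unspecified.\<close>
        define v where "v K = (if K = {} then 0 else dist (f (Inf K)) (f (Sup K)))" for K
        have ne: "K \<noteq> {}" if "(x,K) \<in> q" for x K
          using that tagged_division_ofD(2)[OF p, of x K] by (auto simp: q_def)
        have "(\<Sum>(x,K)\<in>q. v K) = (\<Sum>I\<in>snd ` q. v I)"
        proof (rule sum.over_tagged_division_lemma)
          show "q tagged_division_of \<Union>(snd ` q)"
            by (rule tagged_partial_division_of_Union_self[OF q_part])
          show "v (cbox x y) = 0" if "box x y = {}" for x y :: real
            using that by (cases "x = y") (auto simp: v_def)
        qed
        moreover have "(\<Sum>(x,K)\<in>q. v K) = (\<Sum>(x,K)\<in>q. dist (f (Inf K)) (f (Sup K)))"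
          using ne by (intro sum.cong) (auto simp: v_def)
        moreover have "(\<Sum>I\<in>snd ` q. v I) = (\<Sum>I\<in>snd ` q. dist (f (Inf I)) (f (Sup I)))"
          using ne by (intro sum.cong) (auto simp: v_def)
        ultimately show ?thesis by simp
      qed
      ultimately have q_sum: "(\<Sum>(x,K)\<in>q. dist (f (Inf K)) (f (Sup K))) < e/2" by simp
      have r_sum: "norm (measure lborel K *\<^sub>R h x - (f (Sup K) - f (Inf K))) \<le> c * measure lborel K"
        if "(x,K) \<in> r" for x K
      proof -
        have xK: "(x,K) \<in> p" "x \<notin> N" using that by (auto simp: r_def q_def)
        obtain u v where uv: "K = {u..v}" "u \<le> x" "x \<le> v" "a \<le> u" "v \<le> b" using ivl[OF xK(1)] by blast
        have ball: "\<forall>y\<in>K. y \<in> ball x (d x)"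
          using fine xK unfolding fine_def \<gamma>_def by fastforce
        have "norm ((v - u) *\<^sub>R g x - (f v - f u)) = norm (f u - f x - (u - x) *\<^sub>R g x - (f v - f x - (v - x) *\<^sub>R g x))"
          by (auto simp: algebra_simps)
        also have "\<dots> \<le> norm (f u - f x - (u - x) *\<^sub>R g x) + norm (f v - f x - (v - x) *\<^sub>R g x)"
          by (rule norm_triangle_ineq4)
        also have "\<dots> \<le> c * norm (u - x) + c * norm (v - x)"
        proof (intro add_mono)
          have "u \<in> ball x (d x)" "v \<in> ball x (d x)" using ball uv by auto
          then have near: "norm (u - x) < d x" "norm (v - x) < d x"
            by (auto simp: dist_norm norm_minus_commute)
          show "norm (f u - f x - (u - x) *\<^sub>R g x) \<le> c * norm (u - x)"
            using uv xK(2) by (intro d(2) near) auto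
          show "norm (f v - f x - (v - x) *\<^sub>R g x) \<le> c * norm (v - x)"
            using uv xK(2) by (intro d(2) near) auto
        qed
        also have "\<dots> = c * (v - u)" using uv by (simp add: algebra_simps)
        finally show ?thesis using uv xK by (simp add: h_def)
      qed
      have sum_c: "(\<Sum>(x,K)\<in>p. measure lborel K) = b - a"
        using additive_content_tagged_division[of p a b] p ab by simp
      have "(\<Sum>(x,K)\<in>p. measure lborel K *\<^sub>R h x) - (f b - f a)
        = (\<Sum>(x,K)\<in>p. measure lborel K *\<^sub>R h x - (f (Sup K) - f (Inf K)))"
        using additive_tagged_division_1[OF ab p, of f] by (simp add: sum_subtractf split_def)
      also have "norm \<dots> \<le> (\<Sum>(x,K)\<in>p. norm (measure lborel K *\<^sub>R h x - (f (Sup K) - f (Inf K))))"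
        by (rule norm_sum[THEN order_trans]) (simp add: split_def)
      also have "\<dots> = (\<Sum>(x,K)\<in>q. norm (measure lborel K *\<^sub>R h x - (f (Sup K) - f (Inf K))))
                   + (\<Sum>(x,K)\<in>r. norm (measure lborel K *\<^sub>R h x - (f (Sup K) - f (Inf K))))"
        unfolding prq(1) using fin qp prq(2) by (intro sum.union_disjoint) (auto intro: finite_subset)
      also have "(\<Sum>(x,K)\<in>q. norm (measure lborel K *\<^sub>R h x - (f (Sup K) - f (Inf K))))
          = (\<Sum>(x,K)\<in>q. dist (f (Inf K)) (f (Sup K)))"
        by (intro sum.cong) (auto simp: q_def h_def dist_norm norm_minus_commute)
      also have "(\<Sum>(x,K)\<in>r. norm (measure lborel K *\<^sub>R h x - (f (Sup K) - f (Inf K)))) \<le> (\<Sum>(x,K)\<in>r. c * measure lborel K)"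
        using r_sum by (intro sum_mono) auto
      also have "\<dots> \<le> (\<Sum>(x,K)\<in>p. c * measure lborel K)"
        using fin qp c by (intro sum_mono2) auto
      also have "\<dots> = c * (b - a)"
        using sum_c by (simp add: sum_distrib_left[symmetric] split_def)
      also have "c * (b - a) \<le> e/2"
        using e ab by (simp add: c_def field_simps)
      finally show ?thesis using q_sum by linarith
    qed
    show "\<exists>\<gamma>. gauge \<gamma> \<and> (\<forall>\<D>. \<D> tagged_division_of {a..b} \<and> \<gamma> fine \<D> \<longrightarrow>
        norm ((\<Sum>(x,k)\<in>\<D>. measure lborel k *\<^sub>R h x) - (f b - f a)) < e)"
      by (intro exI[of _ \<gamma>] conjI allI impI gauge) (elim conjE, rule fine_sum)
  qed
qed

text \<open>
  The core of Lebesgue's differentiation theorem. A point of this set is an endpoint of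
  arbitrarily short intervals on which the average of \<open>f\<close> differs from the value of \<open>f\<close> at that
  point by more than \<open>c\<close>. Vitali's lemma selects disjoint ones that cover the set after a fivefold
  enlargement; tagged by these points they form a partial division, and Henstock's lemma makes
  their total deviation, hence their total length, as small as desired.
\<close>

lemma negligible_large_average_deviation:
  fixes f :: "real \<Rightarrow> 'a::euclidean_space"
  assumes f: "f integrable_on {a..b}" and c: "c > 0"
  shows "negligible {s \<in> {a..b}. \<forall>d>0. \<exists>y\<in>{a..b}. y \<noteq> s \<and> \<bar>y - s\<bar> < d \<and>
     norm ((max s y - min s y) *\<^sub>R f s - integral {min s y..max s y} f) > c * \<bar>y - s\<bar>}"
proof -
  define E where "E = {s \<in> {a..b}. \<forall>d>0. \<exists>y\<in>{a..b}. y \<noteq> s \<and> \<bar>y - s\<bar> < d \<and>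
     norm ((max s y - min s y) *\<^sub>R f s - integral {min s y..max s y} f) > c * \<bar>y - s\<bar>}"
  have "\<exists>T. E \<subseteq> T \<and> T \<in> lmeasurable \<and> measure lebesgue T \<le> e" if e: "e > 0" for e :: real
  proof -
  define \<eta> where "\<eta> = c * e / 5"
  have \<eta>: "\<eta> > 0" using c e by (simp add: \<eta>_def)
  obtain \<gamma> where \<gamma>: "gauge \<gamma>"
    and hen: "\<And>p. \<lbrakk>p tagged_partial_division_of {a..b}; \<gamma> fine p\<rbrakk> \<Longrightarrow>
             sum (\<lambda>(x,k). norm (measure lborel k *\<^sub>R f x - integral k f)) p < \<eta>"
    using Henstock_lemma[of f a b \<eta>] f \<eta> by auto
  \<comment> \<open>The partner \<open>y\<close> of a bad point \<open>s\<close>: together they span an interval that is fine for the gauge.\<close>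
  define near where "near s y \<longleftrightarrow> y \<in> {a..b} \<and> y \<noteq> s \<and> \<bar>y - s\<bar> < 1 \<and> {min s y..max s y} \<subseteq> \<gamma> s \<and>
     norm ((max s y - min s y) *\<^sub>R f s - integral {min s y..max s y} f) > c * \<bar>y - s\<bar>" for s y
  have "\<exists>y. near s y" if s: "s \<in> E" for s
  proof -
    obtain r where r: "r > 0" "ball s r \<subseteq> \<gamma> s"
      using \<gamma> unfolding gauge_def by (meson openE)
    have "min r 1 > 0" using r by simp
    with s[unfolded E_def] obtain y where y: "y \<in> {a..b}" "y \<noteq> s" "\<bar>y - s\<bar> < min r 1"
      "norm ((max s y - min s y) *\<^sub>R f s - integral {min s y..max s y} f) > c * \<bar>y - s\<bar>" by blast
    have "{min s y..max s y} \<subseteq> ball s r" using y(3) by (auto simp: dist_norm)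
    with r y show ?thesis by (intro exI[of _ y]) (auto simp: near_def)
  qed
  then obtain Y where "\<And>s. s \<in> E \<Longrightarrow> near s (Y s)" by meson
  then have Y: "\<And>s. s \<in> E \<Longrightarrow> Y s \<in> {a..b}" "\<And>s. s \<in> E \<Longrightarrow> Y s \<noteq> s"
    "\<And>s. s \<in> E \<Longrightarrow> \<bar>Y s - s\<bar> < 1" "\<And>s. s \<in> E \<Longrightarrow> {min s (Y s)..max s (Y s)} \<subseteq> \<gamma> s"
    "\<And>s. s \<in> E \<Longrightarrow> norm ((max s (Y s) - min s (Y s)) *\<^sub>R f s - integral {min s (Y s)..max s (Y s)} f) > c * \<bar>Y s - s\<bar>"
    unfolding near_def by blast+
  define m where "m s = (s + Y s) / 2" for s
  define r where "r s = \<bar>Y s - s\<bar> / 2" for s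
  have cb: "cball (m s) (r s) = {min s (Y s)..max s (Y s)}" for s
    by (auto simp: m_def r_def cball_eq_atLeastAtMost min_def max_def field_simps)
  obtain C where C: "countable C" "C \<subseteq> E"
    "pairwise (\<lambda>i j. disjnt (cball (m i) (r i)) (cball (m j) (r j))) C"
    "E \<subseteq> (\<Union>i\<in>C. cball (m i) (5 * r i))"
  proof (rule Vitali_covering_lemma_cballs[where S=E and K=E and a=m and r=r and B=1])
    show "E \<subseteq> (\<Union>i\<in>E. cball (m i) (r i))"
    proof
      fix s assume "s \<in> E"
      moreover have "s \<in> cball (m s) (r s)" unfolding cb by auto
      ultimately show "s \<in> (\<Union>i\<in>E. cball (m i) (r i))" by blast
    qed
    show "0 < r i \<and> r i \<le> 1" if "i \<in> E" for i
      using Y(2,3)[OF that] by (auto simp: r_def)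
  qed blast
  have bound: "measure lebesgue (\<Union>i\<in>I. cball (m i) (5 * r i)) \<le> e" if I: "I \<subseteq> C" "finite I" for I
  proof -
    define p where "p = (\<lambda>s. (s, cball (m s) (r s))) ` I"
    have IE: "s \<in> E" if "s \<in> I" for s using that I C(2) by blast
    have tp: "p tagged_partial_division_of {a..b}"
      unfolding tagged_partial_division_of_def
    proof (intro conjI allI impI)
      show "finite p" using I by (simp add: p_def)
      fix x K assume "(x,K) \<in> p"
      then have x: "x \<in> I" "K = {min x (Y x)..max x (Y x)}" by (auto simp: p_def cb)
      show "x \<in> K" using x by auto
      show "K \<subseteq> {a..b}" using x IE[OF x(1), unfolded E_def] Y(1)[OF IE[OF x(1)]] by auto
      show "\<exists>u v. K = cbox u v" using x by auto
    next
      fix x1 K1 x2 K2 assume asm: "(x1,K1) \<in> p \<and> (x2,K2) \<in> p \<and> (x1,K1) \<noteq> (x2,K2)"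
      then have x: "x1 \<in> I" "x2 \<in> I" "K1 = cball (m x1) (r x1)" "K2 = cball (m x2) (r x2)" "x1 \<noteq> x2"
        by (auto simp: p_def)
      then have "K1 \<inter> K2 = {}"
        using C(3) I(1) unfolding pairwise_def disjnt_def by blast
      then show "interior K1 \<inter> interior K2 = {}" using interior_subset by blast
    qed
    have fine: "\<gamma> fine p"
      unfolding fine_def p_def using Y(4)[OF IE] by (auto simp: cb)
    have mball: "measure lebesgue (cball (m s) (5 * r s)) = 5 * \<bar>Y s - s\<bar>" for s
      by (simp add: cball_eq_atLeastAtMost r_def)
    have "measure lebesgue (\<Union>i\<in>I. cball (m i) (5 * r i)) \<le> (\<Sum>s\<in>I. 5 * \<bar>Y s - s\<bar>)"
      using measure_UNION_le[OF I(2), of "\<lambda>i. cball (m i) (5 * r i)" lebesgue] by (simp add: mball)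
    also have "\<dots> \<le> (\<Sum>s\<in>I. 5 / c * norm (measure lborel (cball (m s) (r s)) *\<^sub>R f s - integral (cball (m s) (r s)) f))"
    proof (rule sum_mono)
      fix s assume s: "s \<in> I"
      have "c * \<bar>Y s - s\<bar> \<le> norm (measure lborel (cball (m s) (r s)) *\<^sub>R f s - integral (cball (m s) (r s)) f)"
      proof -
        have "min s (Y s) \<le> max s (Y s)" by simp
        then show ?thesis unfolding cb using Y(5)[OF IE[OF s]] by (simp add: content_real del: min_le_iff_disj le_max_iff_disj)
      qed
      then show "5 * \<bar>Y s - s\<bar> \<le> 5 / c * norm (measure lborel (cball (m s) (r s)) *\<^sub>R f s - integral (cball (m s) (r s)) f)"
        using c by (simp add: field_simps)
    qed
    also have "\<dots> = 5 / c * (\<Sum>(x,k)\<in>p. norm (measure lborel k *\<^sub>R f x - integral k f))"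
      unfolding p_def sum_distrib_left by (subst sum.reindex) (auto simp: inj_on_def)
    also have "\<dots> \<le> 5 / c * \<eta>"
      using hen[OF tp fine] c by (intro mult_left_mono) auto
    also have "\<dots> = e" using c by (simp add: \<eta>_def)
    finally show ?thesis .
  qed
  show "\<exists>T. E \<subseteq> T \<and> T \<in> lmeasurable \<and> measure lebesgue T \<le> e"
  proof (intro exI conjI)
    show "E \<subseteq> (\<Union>i\<in>C. cball (m i) (5 * r i))" by (rule C(4))
    show "(\<Union>i\<in>C. cball (m i) (5 * r i)) \<in> lmeasurable"
      by (rule fmeasurable_UN_bound[OF C(1) _ bound]) auto
    show "measure lebesgue (\<Union>i\<in>C. cball (m i) (5 * r i)) \<le> e"
      by (rule measure_UN_bound[OF C(1) _ bound]) auto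
  qed
  qed
  then show ?thesis unfolding negligible_outer_le E_def[symmetric] by blast
qed

theorem lebesgue_differentiation_indefinite_integral:
  fixes f :: "real \<Rightarrow> 'a::euclidean_space"
  assumes f: "f integrable_on {a..b}"
  shows "negligible {s \<in> {a..b}. \<not> ((\<lambda>t. integral {a..t} f) has_vector_derivative f s) (at s within {a..b})}"
proof -
  define E where "E c = {s \<in> {a..b}. \<forall>d>0. \<exists>y\<in>{a..b}. y \<noteq> s \<and> \<bar>y - s\<bar> < d \<and>
     norm ((max s y - min s y) *\<^sub>R f s - integral {min s y..max s y} f) > c * \<bar>y - s\<bar>}" for c :: real
  have neg_E: "negligible (E c)" if "c > 0" for c
    unfolding E_def by (rule negligible_large_average_deviation[OF f that])
  have "negligible (\<Union>(range (\<lambda>n::nat. E (1 / real (Suc n)))))"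
    by (rule negligible_countable_Union) (auto intro!: neg_E simp del: of_nat_Suc)
  then have neg: "negligible (\<Union>n::nat. E (1 / real (Suc n)))" by simp
  have "((\<lambda>t. integral {a..t} f) has_vector_derivative f s) (at s within {a..b})"
    if s: "s \<in> {a..b}" and nE: "\<And>n. s \<notin> E (1 / real (Suc n))" for s
    unfolding has_vector_derivative_def has_derivative_within_alt
  proof (intro conjI allI impI)
    show "bounded_linear (\<lambda>x. x *\<^sub>R f s)" by (rule bounded_linear_scaleR_left)
    fix e :: real
    assume "e > 0"
    then obtain n where n: "1 / real (Suc n) < e" by (metis nat_approx_posE of_nat_Suc)
    have "\<exists>d>0. \<forall>y\<in>{a..b}. \<not> (y \<noteq> s \<and> \<bar>y - s\<bar> < d \<and>
       norm ((max s y - min s y) *\<^sub>R f s - integral {min s y..max s y} f) > 1 / real (Suc n) * \<bar>y - s\<bar>)"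
      using nE[of n] s unfolding E_def by blast
    then obtain d where d0: "d > 0" and "\<forall>y\<in>{a..b}. \<not> (y \<noteq> s \<and> \<bar>y - s\<bar> < d \<and>
       norm ((max s y - min s y) *\<^sub>R f s - integral {min s y..max s y} f) > 1 / real (Suc n) * \<bar>y - s\<bar>)"
      by blast
    then have d: "\<And>y. \<lbrakk>y \<in> {a..b}; y \<noteq> s; \<bar>y - s\<bar> < d\<rbrakk> \<Longrightarrow>
       norm ((max s y - min s y) *\<^sub>R f s - integral {min s y..max s y} f) \<le> 1 / real (Suc n) * \<bar>y - s\<bar>"
      by (meson not_less)
    have "norm (integral {a..y} f - integral {a..s} f - (y - s) *\<^sub>R f s) \<le> e * norm (y - s)"
      if y: "y \<in> {a..b}" "norm (y - s) < d" for y
    proof (cases "y = s")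
      case False
      have int: "f integrable_on {a..y}" "f integrable_on {a..s}"
        using f y s by (auto intro: integrable_on_subinterval)
      have "norm (integral {a..y} f - integral {a..s} f - (y - s) *\<^sub>R f s) =
         norm ((max s y - min s y) *\<^sub>R f s - integral {min s y..max s y} f)"
      proof (cases "s \<le> y")
        case True
        then have "integral {a..y} f = integral {a..s} f + integral {s..y} f"
          using s int Henstock_Kurzweil_Integration.integral_combine[of a s y f] by auto
        then show ?thesis using True by (simp add: norm_minus_commute)
      next
        case False
        then have "integral {a..s} f = integral {a..y} f + integral {y..s} f"
          using y int Henstock_Kurzweil_Integration.integral_combine[of a y s f] by auto
        then show ?thesis using False by (simp add: algebra_simps)
      qed
      also have "\<dots> \<le> 1 / real (Suc n) * \<bar>y - s\<bar>" using d[of y] y False by simp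
      also have "\<dots> \<le> e * norm (y - s)" unfolding real_norm_def using n by (intro mult_right_mono) auto
      finally show ?thesis .
    qed simp
    then show "\<exists>d>0. \<forall>y\<in>{a..b}. norm (y - s) < d \<longrightarrow>
        norm (integral {a..y} f - integral {a..s} f - (y - s) *\<^sub>R f s) \<le> e * norm (y - s)"
      using d0 by blast
  qed
  then show ?thesis by (intro negligible_subset[OF neg]) blast
qed

section \<open>Integral estimates for square-integrable controls\<close>

text \<open>
  The integral of \<open>(a f - b g)\<^sup>2\<close> is nonnegative for all \<open>a\<close> and \<open>b\<close>; this quadratic form has a
  nonpositive discriminant.
\<close>

lemma cauchy_schwarz_integral:
  fixes f g :: "'a::euclidean_space \<Rightarrow> real"
  assumes f: "(\<lambda>x. (f x)\<^sup>2) integrable_on S" and g: "(\<lambda>x. (g x)\<^sup>2) integrable_on S"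
    and fg: "(\<lambda>x. f x * g x) integrable_on S"
  shows "\<bar>integral S (\<lambda>x. f x * g x)\<bar> \<le> sqrt (integral S (\<lambda>x. (f x)\<^sup>2)) * sqrt (integral S (\<lambda>x. (g x)\<^sup>2))"
proof -
  define A B C where "A = integral S (\<lambda>x. (f x)\<^sup>2)" and "B = integral S (\<lambda>x. f x * g x)"
    and "C = integral S (\<lambda>x. (g x)\<^sup>2)"
  have pos: "A \<ge> 0" "C \<ge> 0"
    unfolding A_def C_def by (auto intro!: Henstock_Kurzweil_Integration.integral_nonneg f g)
  have quad: "a\<^sup>2 * A - 2 * a * b * B + b\<^sup>2 * C \<ge> 0" for a b
  proof -
    have "((\<lambda>x. a\<^sup>2 * (f x)\<^sup>2 - 2 * a * b * (f x * g x) + b\<^sup>2 * (g x)\<^sup>2) has_integral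
        a\<^sup>2 * A - 2 * a * b * B + b\<^sup>2 * C) S"
      unfolding A_def B_def C_def
      by (intro has_integral_add has_integral_diff has_integral_mult_right integrable_integral f g fg)
    moreover have "a\<^sup>2 * (f x)\<^sup>2 - 2 * a * b * (f x * g x) + b\<^sup>2 * (g x)\<^sup>2 = (a * f x - b * g x)\<^sup>2" for x
      by (simp add: power2_eq_square algebra_simps)
    ultimately show ?thesis by (metis (no_types, lifting) has_integral_nonneg zero_le_power2)
  qed
  have "B\<^sup>2 \<le> A * C"
  proof (cases "C = 0")
    case True
    have "B = 0"
    proof (rule ccontr)
      assume "B \<noteq> 0"
      have "A - 2 * ((A + 1) / (2 * B)) * B \<ge> 0" using quad[of 1 "(A + 1) / (2 * B)"] True by simp
      with \<open>B \<noteq> 0\<close> show False by simp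
    qed
    then show ?thesis using True by simp
  next
    case False
    then have "C > 0" using pos by simp
    moreover have "C\<^sup>2 * A - 2 * C * B * B + B\<^sup>2 * C \<ge> 0" by (rule quad)
    then have "C * (A * C - B\<^sup>2) \<ge> 0" by (simp add: power2_eq_square algebra_simps)
    ultimately show ?thesis by (simp add: zero_le_mult_iff)
  qed
  then have "sqrt (B\<^sup>2) \<le> sqrt (A * C)" by (rule real_sqrt_le_mono)
  then show ?thesis by (simp add: real_sqrt_mult A_def B_def C_def)
qed

lemma L2_controls_measurable: "u \<in> L2_controls \<Longrightarrow> u \<in> borel_measurable (lebesgue_on {0..1})"
  by (simp add: L2_controls_def)

lemma L2_controls_square_integrable:
  "u \<in> L2_controls \<Longrightarrow> (\<lambda>s. (norm (u s))\<^sup>2) integrable_on {0..1}"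
  by (simp add: L2_controls_def integrable_on_lebesgue_on)

lemma L2_control_norm_eq_integral:
  "u \<in> L2_controls \<Longrightarrow> L2_control_norm u = sqrt (integral {0..1} (\<lambda>s. (norm (u s))\<^sup>2))"
  by (simp add: L2_controls_def L2_control_norm_def lebesgue_integral_eq_integral)

lemma L2_control_norm_nonneg: "L2_control_norm u \<ge> 0"
  unfolding L2_control_norm_def by (intro real_sqrt_ge_zero Bochner_Integration.integral_nonneg) simp

lemma L2_controlsI:
  assumes "u \<in> borel_measurable (lebesgue_on {0..1})" "g integrable_on {0..1}"
    "\<And>s. s \<in> {0..1} \<Longrightarrow> (norm (u s))\<^sup>2 \<le> g s"
  shows "u \<in> L2_controls"
proof -
  have "(\<lambda>s. (norm (u s))\<^sup>2) \<in> borel_measurable (lebesgue_on {0..1})"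
    using assms(1) by measurable
  then have "(\<lambda>s. (norm (u s))\<^sup>2) integrable_on {0..1}"
    by (rule measurable_bounded_by_integrable_imp_integrable[OF _ assms(2)]) (use assms(3) in auto)
  then have "(\<lambda>s. (norm (u s))\<^sup>2) absolutely_integrable_on {0..1}"
    by (rule nonnegative_absolutely_integrable_1) simp
  then show ?thesis
    using assms(1) by (simp add: L2_controls_def integrable_restrict_space set_integrable_def)
qed

text \<open>
  Since \<open>r \<le> 1 + r\<^sup>2\<close>, a bound by a multiple of a square-integrable control is a bound by an
  integrable function. All integrability facts about the right-hand side of the control system
  come from here.
\<close>

lemma L2_dominated_absolutely_integrable:
  fixes g :: "real \<Rightarrow> 'b::euclidean_space"
  assumes u: "u \<in> L2_controls" and g: "g \<in> borel_measurable (lebesgue_on {0..1})"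
    and le: "\<And>s. s \<in> {0..1} \<Longrightarrow> norm (g s) \<le> c * norm (u s)"
  shows "g absolutely_integrable_on {0..1}"
proof (rule measurable_bounded_by_integrable_imp_absolutely_integrable[OF g])
  have "(\<lambda>s. \<bar>c\<bar> * (1 + (norm (u s))\<^sup>2)) integrable_on {0..1}"
    by (intro integrable_on_mult_right integrable_add L2_controls_square_integrable u integrable_const_ivl)
  then show "(\<lambda>s. \<bar>c\<bar> * (1 + (norm (u s))\<^sup>2)) integrable_on {0..1}" .
  fix s :: real
  assume s: "s \<in> {0..1}"
  have "norm (g s) \<le> \<bar>c\<bar> * norm (u s)"
    by (rule order_trans[OF le[OF s]]) (intro mult_right_mono, auto)
  also have "norm (u s) \<le> 1 + (norm (u s))\<^sup>2"
    using sum_squares_ge_zero[of "norm (u s) - 1/2" 0] by (simp add: power2_eq_square algebra_simps)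
  finally show "norm (g s) \<le> \<bar>c\<bar> * (1 + (norm (u s))\<^sup>2)" by (simp add: mult_left_mono)
qed simp

lemma L2_controls_absolutely_integrable: "u \<in> L2_controls \<Longrightarrow> u absolutely_integrable_on {0..1}"
  by (rule L2_dominated_absolutely_integrable[where c=1]) (auto simp: L2_controls_measurable)

lemma L2_controls_norm_integrable: "u \<in> L2_controls \<Longrightarrow> (\<lambda>s. norm (u s)) integrable_on {0..1}"
  using L2_controls_absolutely_integrable absolutely_integrable_on_def by blast

lemma L2_controls_square_integral_le:
  assumes u: "u \<in> L2_controls" and "T \<subseteq> {0..1}" and "(\<lambda>s. (norm (u s))\<^sup>2) integrable_on T"
  shows "sqrt (integral T (\<lambda>s. (norm (u s))\<^sup>2)) \<le> L2_control_norm u"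
  unfolding L2_control_norm_eq_integral[OF u]
  by (intro real_sqrt_le_mono integral_subset_le assms L2_controls_square_integrable) simp

lemma L2_weighted_integrable:
  assumes u: "u \<in> L2_controls" and t: "t \<in> {0..1}" and w: "continuous_on {0..1} w"
  shows "(\<lambda>s. norm (u s) * w s) integrable_on {0..t}"
proof -
  obtain c where c: "\<forall>s\<in>{0..1}. norm (w s) \<le> c"
    using compact_imp_bounded[OF compact_continuous_image[OF w compact_Icc]] unfolding bounded_iff by auto
  have m: "w \<in> borel_measurable (lebesgue_on {0..1})"
    by (rule continuous_imp_measurable_on_sets_lebesgue[OF w]) simp
  have "(\<lambda>s. w s * norm (u s)) absolutely_integrable_on {0..1}"
    using L2_controls_measurable[OF u] m c
    by (intro L2_dominated_absolutely_integrable[OF u, where c=c]) (auto simp: abs_mult mult_right_mono)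
  then have "(\<lambda>s. w s * norm (u s)) integrable_on {0..1}"
    by (simp add: absolutely_integrable_on_def)
  then have "(\<lambda>s. w s * norm (u s)) integrable_on {0..t}"
    by (rule integrable_on_subinterval) (use t in auto)
  then show ?thesis by (simp add: mult.commute)
qed

lemma L2_controls_weighted_integral_le:
  assumes u: "u \<in> L2_controls" and t: "t \<in> {0..1}" and w: "continuous_on {0..1} w"
  shows "integral {0..t} (\<lambda>s. norm (u s) * w s) \<le> L2_control_norm u * sqrt (integral {0..t} (\<lambda>s. (w s)\<^sup>2))"
proof -
  have sub: "{0..t} \<subseteq> {0..1}" using t by auto
  have i1: "(\<lambda>s. (norm (u s))\<^sup>2) integrable_on {0..t}"
    using integrable_on_subinterval[OF L2_controls_square_integrable[OF u] sub] .
  have wc: "continuous_on {0..t} w" using continuous_on_subset[OF w sub] .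
  have "integral {0..t} (\<lambda>s. norm (u s) * w s) \<le> sqrt (integral {0..t} (\<lambda>s. (norm (u s))\<^sup>2)) * sqrt (integral {0..t} (\<lambda>s. (w s)\<^sup>2))"
    by (rule order_trans[OF abs_ge_self cauchy_schwarz_integral])
      (intro i1 L2_weighted_integrable[OF u t w] integrable_continuous_real continuous_intros wc)+
  also have "\<dots> \<le> L2_control_norm u * sqrt (integral {0..t} (\<lambda>s. (w s)\<^sup>2))"
    using L2_controls_square_integral_le[OF u sub i1]
    by (intro mult_right_mono real_sqrt_ge_zero Henstock_Kurzweil_Integration.integral_nonneg
        integrable_continuous_real continuous_intros wc) auto
  finally show ?thesis .
qed

text \<open>
  The factor \<open>1 / sqrt (2 \<rho>)\<close> becomes as small as desired for large \<open>\<rho>\<close>. This gain makes the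
  Picard operator a contraction in the weighted norm \<open>sup\<^sub>t exp (- \<rho> t) |x t|\<close>, although the
  kernel is only square-integrable.
\<close>

lemma L2_controls_exp_integral_le:
  assumes u: "u \<in> L2_controls" and t: "t \<in> {0..1}" and "\<rho> > 0"
  shows "integral {0..t} (\<lambda>s. norm (u s) * exp (\<rho> * s)) \<le> L2_control_norm u / sqrt (2 * \<rho>) * exp (\<rho> * t)"
proof -
  have "((\<lambda>s. (exp (\<rho> * s))\<^sup>2) has_integral (exp (2 * \<rho> * t) / (2 * \<rho>) - exp (2 * \<rho> * 0) / (2 * \<rho>))) {0..t}"
    using t \<open>\<rho> > 0\<close>
    by (intro fundamental_theorem_of_calculus)
      (auto intro!: derivative_eq_intros simp: has_real_derivative_iff_has_vector_derivative[symmetric] exp_double[symmetric] algebra_simps)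
  then have "integral {0..t} (\<lambda>s. (exp (\<rho> * s))\<^sup>2) \<le> exp (2 * \<rho> * t) / (2 * \<rho>)"
    using \<open>\<rho> > 0\<close> by (simp add: integral_unique)
  then have "sqrt (integral {0..t} (\<lambda>s. (exp (\<rho> * s))\<^sup>2)) \<le> sqrt ((exp (\<rho> * t))\<^sup>2 / (2 * \<rho>))"
    by (intro real_sqrt_le_mono) (simp add: exp_double[symmetric] mult.assoc)
  also have "\<dots> = exp (\<rho> * t) / sqrt (2 * \<rho>)" by (simp add: real_sqrt_divide)
  finally have "L2_control_norm u * sqrt (integral {0..t} (\<lambda>s. (exp (\<rho> * s))\<^sup>2)) \<le> L2_control_norm u * (exp (\<rho> * t) / sqrt (2 * \<rho>))"
    by (intro mult_left_mono L2_control_norm_nonneg)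
  with L2_controls_weighted_integral_le[OF u t, of "\<lambda>s. exp (\<rho> * s)"] show ?thesis
    by (fastforce intro!: continuous_intros)
qed

text \<open>
  Increments of a curve with speed at most \<open>|u|\<close> are controlled by the total length of the
  intervals, which yields absolute continuity.
\<close>

lemma L2_controls_division_sum_le:
  assumes u: "u \<in> L2_controls" and D: "D division_of T" and T: "T \<subseteq> {0..1}"
  shows "(\<Sum>I\<in>D. integral I (\<lambda>s. norm (u s))) \<le> L2_control_norm u * sqrt (\<Sum>I\<in>D. measure lborel I)"
proof -
  have i: "(\<lambda>s. (norm (u s))\<^sup>2) integrable_on T" "(\<lambda>s. norm (u s)) integrable_on T" "(\<lambda>s. 1::real) integrable_on T"
    by (intro integrable_on_subdivision[OF D _ T] L2_controls_square_integrable[OF u] L2_controls_norm_integrable[OF u] integrable_const_ivl)+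
  have "integral T (\<lambda>s. 1::real) = (\<Sum>I\<in>D. integral I (\<lambda>s. 1))"
    by (rule integral_combine_division_topdown[OF i(3) D])
  also have "\<dots> = (\<Sum>I\<in>D. measure lborel I)"
    using division_ofD(4)[OF D] by (intro sum.cong refl) fastforce
  finally have one: "integral T (\<lambda>s. 1::real) = (\<Sum>I\<in>D. measure lborel I)" .
  have "(\<Sum>I\<in>D. integral I (\<lambda>s. norm (u s))) = integral T (\<lambda>s. norm (u s) * 1)"
    using integral_combine_division_topdown[OF i(2) D] by simp
  also have "\<dots> \<le> sqrt (integral T (\<lambda>s. (norm (u s))\<^sup>2)) * sqrt (integral T (\<lambda>s. 1\<^sup>2))"
    by (rule order_trans[OF abs_ge_self cauchy_schwarz_integral]) (use i in auto)
  also have "\<dots> \<le> L2_control_norm u * sqrt (\<Sum>I\<in>D. measure lborel I)"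
    using L2_controls_square_integral_le[OF u T i(1)] by (simp add: one mult_right_mono sum_nonneg)
  finally show ?thesis .
qed

section \<open>Integral inequalities with a square-integrable kernel\<close>

text \<open>
  The exponent \<open>2 (K M)\<^sup>2 + 1\<close> is chosen so that \<open>K M / sqrt (2 \<rho>) \<le> 1/2\<close>: integration against the
  kernel halves the weighted norm.
\<close>

lemma L2_kernel_exp_contraction:
  assumes u: "u \<in> L2_controls" and M: "L2_control_norm u \<le> M" and K: "K \<ge> 0"
    and z: "continuous_on {0..1} z" "\<And>s. s \<in> {0..1} \<Longrightarrow> z s \<le> S * exp ((2 * (K * M)\<^sup>2 + 1) * s)"
    and S: "S \<ge> 0" and t: "t \<in> {0..1}"
  shows "K * integral {0..t} (\<lambda>s. norm (u s) * z s) \<le> S / 2 * exp ((2 * (K * M)\<^sup>2 + 1) * t)"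
proof -
  define \<rho> where "\<rho> = 2 * (K * M)\<^sup>2 + 1"
  have \<rho>: "\<rho> > 0" unfolding \<rho>_def using zero_le_power2[of "K * M"] by linarith
  have z': "z s \<le> S * exp (\<rho> * s)" if "s \<in> {0..1}" for s
    using z(2)[OF that] by (simp add: \<rho>_def)
  have "integral {0..t} (\<lambda>s. norm (u s) * z s) \<le> integral {0..t} (\<lambda>s. S * (norm (u s) * exp (\<rho> * s)))"
  proof (rule integral_le)
    show "(\<lambda>s. S * (norm (u s) * exp (\<rho> * s))) integrable_on {0..t}"
      by (intro integrable_on_mult_right L2_weighted_integrable u t continuous_intros)
    show "norm (u s) * z s \<le> S * (norm (u s) * exp (\<rho> * s))" if "s \<in> {0..t}" for s
      using mult_left_mono[OF z'[of s], of "norm (u s)"] that t by (simp add: mult_ac)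
  qed (rule L2_weighted_integrable[OF u t z(1)])
  also have "\<dots> = S * integral {0..t} (\<lambda>s. norm (u s) * exp (\<rho> * s))" by simp
  also have "\<dots> \<le> S * (L2_control_norm u / sqrt (2 * \<rho>) * exp (\<rho> * t))"
    by (intro mult_left_mono L2_controls_exp_integral_le u t \<rho> S)
  also have "\<dots> \<le> S * (M / sqrt (2 * \<rho>) * exp (\<rho> * t))"
    using M \<rho> by (intro mult_left_mono mult_right_mono divide_right_mono S) auto
  finally have "K * integral {0..t} (\<lambda>s. norm (u s) * z s) \<le> K * (S * (M / sqrt (2 * \<rho>) * exp (\<rho> * t)))"
    using K by (rule mult_left_mono)
  also have "\<dots> = (K * M / sqrt (2 * \<rho>)) * (S * exp (\<rho> * t))" by simp
  also have "\<dots> \<le> 1/2 * (S * exp (\<rho> * t))"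
  proof (intro mult_right_mono)
    have "2 * (K * M) \<le> sqrt (2 * \<rho>)"
      by (rule real_le_rsqrt) (simp add: \<rho>_def power_mult_distrib)
    then show "K * M / sqrt (2 * \<rho>) \<le> 1/2" using \<rho> by (simp add: field_simps)
  qed (use S in simp)
  finally show ?thesis by (simp add: \<rho>_def)
qed

text \<open>
  At the point where the weighted function \<open>exp (- \<rho> t) z t\<close> is maximal, the integral term is at
  most half of \<open>z\<close>, so that it can be absorbed on the left-hand side.
\<close>

lemma L2_kernel_gronwall:
  assumes u: "u \<in> L2_controls" and M: "L2_control_norm u \<le> M" and K: "K \<ge> 0"
    and z: "continuous_on {0..1} z" "\<And>t. t \<in> {0..1} \<Longrightarrow> z t \<ge> 0"
    and le: "\<And>t. t \<in> {0..1} \<Longrightarrow> z t \<le> a + K * integral {0..t} (\<lambda>s. norm (u s) * z s)"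
    and t: "t \<in> {0..1}"
  shows "z t \<le> 2 * a * exp (2 * (K * M)\<^sup>2 + 1)"
proof -
  define \<rho> where "\<rho> = 2 * (K * M)\<^sup>2 + 1"
  have \<rho>: "\<rho> > 0" unfolding \<rho>_def using zero_le_power2[of "K * M"] by linarith
  obtain t0 where t0: "t0 \<in> {0..1}" and sup: "\<And>s. s \<in> {0..1} \<Longrightarrow> exp (- \<rho> * s) * z s \<le> exp (- \<rho> * t0) * z t0"
    using continuous_attains_sup[of "{0..1::real}" "\<lambda>s. exp (- \<rho> * s) * z s"]
    by (force intro!: continuous_intros z)
  define S where "S = exp (- \<rho> * t0) * z t0"
  have S0: "S \<ge> 0" using z(2)[OF t0] by (simp add: S_def)
  have zle: "z s \<le> S * exp (\<rho> * s)" if "s \<in> {0..1}" for s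
    using sup[OF that] by (simp add: S_def exp_minus field_simps)
  have "K * integral {0..t0} (\<lambda>s. norm (u s) * z s) \<le> S / 2 * exp (\<rho> * t0)"
    unfolding \<rho>_def by (rule L2_kernel_exp_contraction[OF u M K z(1) _ S0 t0]) (rule zle[unfolded \<rho>_def])
  moreover have "S * exp (\<rho> * t0) = z t0" by (simp add: S_def exp_minus field_simps)
  ultimately have z0: "z t0 \<le> 2 * a" using le[OF t0] by simp
  then have a0: "a \<ge> 0" using z(2)[OF t0] by linarith
  have "S \<le> 1 * z t0"
    unfolding S_def using \<rho> t0 z(2)[OF t0] by (intro mult_right_mono) auto
  with z0 have "S \<le> 2 * a" by linarith
  have "z t \<le> S * exp (\<rho> * t)" by (rule zle[OF t])
  also have "\<dots> \<le> 2 * a * exp (\<rho> * 1)"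
    using \<open>S \<le> 2 * a\<close> \<rho> t a0 by (intro mult_mono) auto
  finally show ?thesis by (simp add: \<rho>_def)
qed

section \<open>The integral equation of a control system\<close>

text \<open>
  The only properties of the vector fields that the proof uses. One constant serves for the growth
  and for the Lipschitz estimate.
\<close>

locale control_system =
  fixes F :: "'l::finite \<Rightarrow> real^'n \<Rightarrow> real^'n" and C :: real
  assumes C_nonneg: "C \<ge> 0"
    and continuous_fields: "\<And>i. continuous_on UNIV (F i)"
    and velocity_bounded: "\<And>v y. norm (\<Sum>i\<in>UNIV. v $ i *\<^sub>R F i y) \<le> C * norm (v :: real^'l)"
    and velocity_lipschitz: "\<And>v y z. norm ((\<Sum>i\<in>UNIV. v $ i *\<^sub>R F i y) - (\<Sum>i\<in>UNIV. v $ i *\<^sub>R F i z))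
        \<le> C * norm (v :: real^'l) * norm (y - z)"
begin

definition velocity :: "real^'l \<Rightarrow> real^'n \<Rightarrow> real^'n" where
  "velocity v y = (\<Sum>i\<in>UNIV. v $ i *\<^sub>R F i y)"

lemma norm_velocity_le: "norm (velocity v y) \<le> C * norm v"
  unfolding velocity_def by (rule velocity_bounded)

lemma norm_velocity_diff_le: "norm (velocity v y - velocity v z) \<le> C * norm v * norm (y - z)"
  unfolding velocity_def by (rule velocity_lipschitz)

lemma velocity_diff_left: "velocity (v - w) y = velocity v y - velocity w y"
  by (simp add: velocity_def scaleR_left_diff_distrib sum_subtractf)

lemma velocity_measurable:
  assumes u: "u \<in> L2_controls" and x: "continuous_on {0..1} x"
  shows "(\<lambda>s. velocity (u s) (x s)) \<in> borel_measurable (lebesgue_on {0..1})"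
proof -
  have "(\<lambda>s. F i (x s)) \<in> borel_measurable (lebesgue_on {0..1})" for i
    by (intro continuous_imp_measurable_on_sets_lebesgue continuous_on_compose2[OF continuous_fields x]) auto
  moreover have "(\<lambda>s. u s $ i) \<in> borel_measurable (lebesgue_on {0..1})" for i
    by (intro borel_measurable_continuous_on[OF _ L2_controls_measurable[OF u]] continuous_intros)
  ultimately show ?thesis
    unfolding velocity_def by (intro borel_measurable_sum borel_measurable_scaleR)
qed

lemma velocity_absolutely_integrable:
  assumes "u \<in> L2_controls" "continuous_on {0..1} x"
  shows "(\<lambda>s. velocity (u s) (x s)) absolutely_integrable_on {0..1}"
  by (rule L2_dominated_absolutely_integrable[OF assms(1) velocity_measurable[OF assms] norm_velocity_le])

lemma velocity_integrable:
  assumes "u \<in> L2_controls" "continuous_on {0..1} x" "{a..b} \<subseteq> {0..1}"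
  shows "(\<lambda>s. velocity (u s) (x s)) integrable_on {a..b}"
  using integrable_on_subinterval[OF _ assms(3)] velocity_absolutely_integrable[OF assms(1,2)]
    absolutely_integrable_on_def by blast

lemma norm_velocity_integral_diff_le:
  assumes u: "u \<in> L2_controls" and x: "continuous_on {0..1} x" and y: "continuous_on {0..1} y" and t: "t \<in> {0..1}"
  shows "norm (integral {0..t} (\<lambda>s. velocity (u s) (x s)) - integral {0..t} (\<lambda>s. velocity (u s) (y s)))
     \<le> C * integral {0..t} (\<lambda>s. norm (u s) * norm (x s - y s))"
proof -
  have sub: "{0..t} \<subseteq> {0..1}" using t by auto
  have "norm (integral {0..t} (\<lambda>s. velocity (u s) (x s) - velocity (u s) (y s)))
     \<le> integral {0..t} (\<lambda>s. C * (norm (u s) * norm (x s - y s)))"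
    using norm_velocity_diff_le
    by (intro integral_norm_bound_integral integrable_diff velocity_integrable u x y sub integrable_on_mult_right
        L2_weighted_integrable[OF u t] continuous_intros) (simp add: mult.assoc)
  then show ?thesis
    by (subst (asm) Henstock_Kurzweil_Integration.integral_diff) (auto intro!: velocity_integrable u x y sub simp: t)
qed

definition integral_solution :: "(real \<Rightarrow> real^'l) \<Rightarrow> real^'n \<Rightarrow> (real \<Rightarrow> real^'n) \<Rightarrow> bool" where
  "integral_solution u x0 x \<longleftrightarrow> continuous_on {0..1} x \<and>
     (\<forall>t\<in>{0..1}. x t = x0 + integral {0..t} (\<lambda>s. velocity (u s) (x s)))"

text \<open>
  The difference of two trajectories splits into the effect of the different positions, which is
  left to the Gronwall inequality, and the effect of the different controls along the fixed curve
  \<open>y\<close>. Only the primitive of the latter has to be small, so the estimate survives weak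
  convergence of the controls.
\<close>

lemma integral_solution_stable:
  assumes u: "u \<in> L2_controls" and v: "v \<in> L2_controls" and M: "L2_control_norm u \<le> M"
    and x: "integral_solution u x0 x" and y: "integral_solution v x0 y"
    and a: "\<And>t. t \<in> {0..1} \<Longrightarrow> norm (integral {0..t} (\<lambda>s. velocity (u s - v s) (y s))) \<le> a"
    and t: "t \<in> {0..1}"
  shows "norm (x t - y t) \<le> 2 * a * exp (2 * (C * M)\<^sup>2 + 1)"
proof (rule L2_kernel_gronwall[OF u M C_nonneg _ _ _ t])
  have xc: "continuous_on {0..1} x" and yc: "continuous_on {0..1} y"
    using x y by (auto simp: integral_solution_def)
  show "continuous_on {0..1} (\<lambda>t. norm (x t - y t))" by (intro continuous_intros xc yc)
  fix t :: real assume t: "t \<in> {0..1}"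
  have sub: "{0..t} \<subseteq> {0..1}" using t by auto
  have "x t - y t = integral {0..t} (\<lambda>s. velocity (u s) (x s)) - integral {0..t} (\<lambda>s. velocity (v s) (y s))"
    using x y t by (simp add: integral_solution_def)
  also have "\<dots> = (integral {0..t} (\<lambda>s. velocity (u s) (x s)) - integral {0..t} (\<lambda>s. velocity (u s) (y s)))
      + integral {0..t} (\<lambda>s. velocity (u s - v s) (y s))"
    unfolding velocity_diff_left
    by (subst Henstock_Kurzweil_Integration.integral_diff) (auto intro!: velocity_integrable u v yc sub simp: t)
  also have "norm \<dots> \<le> C * integral {0..t} (\<lambda>s. norm (u s) * norm (x s - y s)) + a"
    by (intro norm_triangle_mono norm_velocity_integral_diff_le u xc yc t a)
  finally show "norm (x t - y t) \<le> a + C * integral {0..t} (\<lambda>s. norm (u s) * norm (x s - y s))" by simp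
qed simp

lemma integral_solution_unique:
  assumes "u \<in> L2_controls" "integral_solution u x0 x" "integral_solution u x0 y" "t \<in> {0..1}"
  shows "x t = y t"
proof -
  have "norm (x t - y t) \<le> 2 * 0 * exp (2 * (C * L2_control_norm u)\<^sup>2 + 1)"
    using assms by (intro integral_solution_stable[of u u]) (auto simp: velocity_def)
  then show ?thesis by simp
qed

end

section \<open>Existence of trajectories and Caratheodory solutions\<close>

lemma abs_continuous_on_imp_continuous_on:
  assumes "abs_continuous_on {a..b} f"
  shows "continuous_on {a..b} f"
  unfolding continuous_on_iff
proof (intro ballI allI impI)
  fix s e :: real
  assume s: "s \<in> {a..b}" and "e > 0"
  then obtain \<delta> where \<delta>: "\<delta> > 0" and ac: "\<And>D T. \<lbrakk>D division_of T; T \<subseteq> {a..b}; (\<Sum>I\<in>D. measure lborel I) < \<delta>\<rbrakk>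
          \<Longrightarrow> (\<Sum>I\<in>D. dist (f (Inf I)) (f (Sup I))) < e"
    using assms unfolding abs_continuous_on_def by meson
  have "dist (f t) (f s) < e" if t: "t \<in> {a..b}" "dist t s < \<delta>" for t
  proof -
    have ord: "min s t \<le> max s t" by simp
    then have "{{min s t..max s t}} division_of {min s t..max s t}"
      using division_of_self[of "min s t" "max s t"] by (simp del: min_le_iff_disj le_max_iff_disj)
    moreover have "{min s t..max s t} \<subseteq> {a..b}" using s t by auto
    moreover have "(\<Sum>I\<in>{{min s t..max s t}}. measure lborel I) < \<delta>"
      using t by (auto simp: dist_real_def min_def max_def)
    ultimately have "(\<Sum>I\<in>{{min s t..max s t}}. dist (f (Inf I)) (f (Sup I))) < e" by (rule ac)
    then show ?thesis by (cases "s \<le> t") (auto simp: min_def max_def dist_commute)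
  qed
  then show "\<exists>d>0. \<forall>x'\<in>{a..b}. dist x' s < d \<longrightarrow> dist (f x') (f s) < e"
    using \<delta> by blast
qed

context control_system
begin

text \<open>
  Picard iteration: consecutive differences are halved in the weighted norm, so the iterates
  converge uniformly, and the limit is a fixed point.
\<close>

lemma integral_solution_exists:
  assumes u: "u \<in> L2_controls"
  shows "\<exists>x. integral_solution u x0 x"
proof -
  define T where "T x t = x0 + integral {0..t} (\<lambda>s. velocity (u s) (x s))" for x t
  define \<rho> where "\<rho> = 2 * (C * L2_control_norm u)\<^sup>2 + 1"
  have \<rho>: "\<rho> > 0" unfolding \<rho>_def using zero_le_power2[of "C * L2_control_norm u"] by linarith
  have T_cont: "continuous_on {0..1} (T x)" if "continuous_on {0..1} x" for x
    unfolding T_def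
    by (intro continuous_intros indefinite_integral_continuous_1 velocity_integrable u that) simp
  have contraction: "norm (T x t - T y t) \<le> S / 2 * exp (\<rho> * t)"
    if x: "continuous_on {0..1} x" and y: "continuous_on {0..1} y" and S: "S \<ge> 0"
      and le: "\<And>s. s \<in> {0..1} \<Longrightarrow> norm (x s - y s) \<le> S * exp (\<rho> * s)" and t: "t \<in> {0..1}" for x y S t
  proof -
    have "norm (T x t - T y t) \<le> C * integral {0..t} (\<lambda>s. norm (u s) * norm (x s - y s))"
      using norm_velocity_integral_diff_le[OF u x y t] by (simp add: T_def)
    also have "\<dots> \<le> S / 2 * exp (\<rho> * t)"
      unfolding \<rho>_def
      by (rule L2_kernel_exp_contraction[OF u order_refl C_nonneg _ _ S t])
        (use le in \<open>auto intro!: continuous_intros x y simp: \<rho>_def\<close>)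
    finally show ?thesis .
  qed
  define X where "X n = (T ^^ n) (\<lambda>_. x0)" for n
  have X_Suc: "X (Suc n) = T (X n)" for n by (simp add: X_def)
  have X_cont: "continuous_on {0..1} (X n)" for n
    by (induction n) (simp_all add: X_Suc T_cont, simp add: X_def)
  obtain B where B: "\<forall>t\<in>{0..1}. norm (X 1 t - X 0 t) \<le> B"
    using compact_imp_bounded[OF compact_continuous_image[OF continuous_on_diff[OF X_cont[of 1] X_cont[of 0]] compact_Icc]]
    unfolding bounded_iff by auto
  have B0: "B \<ge> 0" using B by (meson atLeastAtMost_iff norm_ge_zero order_refl order_trans zero_le_one)
  have step: "norm (X (Suc n) t - X n t) \<le> B * (1/2)^n * exp (\<rho> * t)" if "t \<in> {0..1}" for n t
    using that
  proof (induction n arbitrary: t)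
    case 0
    have "norm (X 1 t - X 0 t) \<le> B * 1" using B 0 by simp
    also have "\<dots> \<le> B * exp (\<rho> * t)" using B0 \<rho> 0 by (intro mult_left_mono) auto
    finally show ?case by simp
  next
    case (Suc n)
    have "norm (T (X (Suc n)) t - T (X n) t) \<le> (B * (1/2)^n) / 2 * exp (\<rho> * t)"
      by (rule contraction[OF X_cont X_cont _ Suc.IH Suc.prems]) (use B0 in simp_all)
    then show ?case by (simp add: X_Suc)
  qed
  define x where "x t = x0 + (\<Sum>n. X (Suc n) t - X n t)" for t
  have "uniform_limit {0..1} (\<lambda>n t. \<Sum>i<n. X (Suc i) t - X i t) (\<lambda>t. \<Sum>i. X (Suc i) t - X i t) sequentially"
  proof (rule Weierstrass_m_test)
    show "norm (X (Suc n) t - X n t) \<le> B * exp \<rho> * (1/2)^n" if "t \<in> {0..1}" for n t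
    proof -
      have "norm (X (Suc n) t - X n t) \<le> B * (1/2)^n * exp (\<rho> * t)" by (rule step[OF that])
      also have "\<dots> \<le> B * (1/2)^n * exp \<rho>" using B0 \<rho> that by (intro mult_left_mono) auto
      finally show ?thesis by (simp add: mult_ac)
    qed
    show "summable (\<lambda>n. B * exp \<rho> * (1/2)^n)" by (intro summable_mult summable_geometric) simp
  qed
  moreover have "(\<Sum>i<n. X (Suc i) t - X i t) = X n t - x0" for n t
    by (subst sum_lessThan_telescope) (simp add: X_def)
  ultimately have lim: "uniform_limit {0..1} X x sequentially"
    unfolding uniform_limit_iff x_def dist_norm by (simp add: diff_diff_eq)
  have x_cont: "continuous_on {0..1} x"
    by (rule uniform_limit_theorem[OF _ lim]) (auto intro: always_eventually X_cont)
  have "x t = T x t" if t: "t \<in> {0..1}" for t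
  proof -
    have "norm (x t - T x t) \<le> 0 + e" if e: "e > 0" for e
    proof -
      define d where "d = e / (1 + exp (\<rho> * t))"
      have pos: "1 + exp (\<rho> * t) > 0" by (simp add: add_pos_pos)
      have d: "d > 0" using e pos by (simp add: d_def)
      then obtain N where N: "\<And>n s. n \<ge> N \<Longrightarrow> s \<in> {0..1} \<Longrightarrow> norm (X n s - x s) < d"
        using lim unfolding uniform_limit_sequentially_iff dist_norm by meson
      have "norm (X N s - x s) \<le> d * exp (\<rho> * s)" if "s \<in> {0..1}" for s
      proof -
        have "norm (X N s - x s) \<le> d * 1" using N[of N s] that by simp
        also have "\<dots> \<le> d * exp (\<rho> * s)" using d \<rho> that by (intro mult_left_mono) auto
        finally show ?thesis .
      qed
      then have "norm (T (X N) t - T x t) \<le> d / 2 * exp (\<rho> * t)"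
        using d by (intro contraction X_cont x_cont t) auto
      also have "\<dots> \<le> d * exp (\<rho> * t)" using d by simp
      finally have "norm (X (Suc N) t - T x t) \<le> d * exp (\<rho> * t)" by (simp add: X_Suc)
      moreover have "norm (x t - X (Suc N) t) \<le> d"
        using N[of "Suc N" t] t by (simp add: norm_minus_commute)
      ultimately have "norm (x t - T x t) \<le> d + d * exp (\<rho> * t)"
        by (rule norm_diff_triangle_le[rotated])
      also have "\<dots> = d * (1 + exp (\<rho> * t))" by (simp add: algebra_simps)
      also have "\<dots> = e" using pos by (simp add: d_def)
      finally show ?thesis by simp
    qed
    then have "norm (x t - T x t) \<le> 0" by (rule field_le_epsilon)
    then show ?thesis by simp
  qed
  then show ?thesis using x_cont by (auto simp: integral_solution_def T_def)
qed

lemma integral_solution_imp_caratheodory: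
  assumes u: "u \<in> L2_controls" and x: "integral_solution u x0 x"
  shows "caratheodory_solution F u x0 x"
  unfolding caratheodory_solution_def
proof (intro conjI)
  have xc: "continuous_on {0..1} x" and eq: "\<And>t. t \<in> {0..1} \<Longrightarrow> x t = x0 + integral {0..t} (\<lambda>s. velocity (u s) (x s))"
    using x by (auto simp: integral_solution_def)
  show "x 0 = x0" using eq[of 0] by simp
  have inc: "dist (x a) (x b) \<le> C * integral {a..b} (\<lambda>s. norm (u s))" if ab: "a \<le> b" "{a..b} \<subseteq> {0..1}" for a b
  proof -
    have "integral {0..b} (\<lambda>s. velocity (u s) (x s)) = integral {0..a} (\<lambda>s. velocity (u s) (x s)) + integral {a..b} (\<lambda>s. velocity (u s) (x s))"
      using ab by (intro Henstock_Kurzweil_Integration.integral_combine[symmetric] velocity_integrable u xc) auto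
    then have "dist (x a) (x b) = norm (integral {a..b} (\<lambda>s. velocity (u s) (x s)))"
      using eq[of a] eq[of b] ab by (simp add: dist_norm norm_minus_commute)
    also have "\<dots> \<le> integral {a..b} (\<lambda>s. C * norm (u s))"
      using norm_velocity_le integrable_on_subinterval[OF L2_controls_norm_integrable[OF u] ab(2)]
      by (intro integral_norm_bound_integral velocity_integrable u xc ab(2) integrable_on_mult_right) auto
    finally show ?thesis by simp
  qed
  show "abs_continuous_on {0..1} x"
    unfolding abs_continuous_on_def
  proof (intro allI impI)
    fix e :: real assume e: "e > 0"
    define M where "M = C * L2_control_norm u + 1"
    have M: "M > 0" unfolding M_def using C_nonneg L2_control_norm_nonneg[of u] by (simp add: add_nonneg_pos)
    have "(\<Sum>I\<in>D. dist (x (Inf I)) (x (Sup I))) < e"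
      if D: "D division_of T" "T \<subseteq> {0..1}" "(\<Sum>I\<in>D. measure lborel I) < (e / M)\<^sup>2" for D T
    proof -
      have "(\<Sum>I\<in>D. dist (x (Inf I)) (x (Sup I))) \<le> (\<Sum>I\<in>D. C * integral I (\<lambda>s. norm (u s)))"
      proof (rule sum_mono)
        fix I assume I: "I \<in> D"
        obtain a b where ab: "I = {a..b}" using division_ofD(4)[OF D(1) I] by auto
        have "I \<noteq> {}" "I \<subseteq> {0..1}" using division_ofD(2,3)[OF D(1) I] D(2) by blast+
        then have "a \<le> b" "{a..b} \<subseteq> {0..1}" using ab by simp_all
        then show "dist (x (Inf I)) (x (Sup I)) \<le> C * integral I (\<lambda>s. norm (u s))"
          using inc[of a b] ab by simp
      qed
      also have "\<dots> = C * (\<Sum>I\<in>D. integral I (\<lambda>s. norm (u s)))" by (simp add: sum_distrib_left)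
      also have "\<dots> \<le> C * (L2_control_norm u * sqrt (\<Sum>I\<in>D. measure lborel I))"
        by (intro mult_left_mono L2_controls_division_sum_le[OF u D(1,2)] C_nonneg)
      also have "\<dots> \<le> M * sqrt (\<Sum>I\<in>D. measure lborel I)"
        by (simp add: M_def algebra_simps sum_nonneg)
      also have "\<dots> < M * sqrt ((e / M)\<^sup>2)"
        using M D(3) by (intro mult_strict_left_mono real_sqrt_less_mono)
      also have "\<dots> = e" using M e by simp
      finally show ?thesis .
    qed
    then show "\<exists>\<delta>>0. \<forall>D T. D division_of T \<longrightarrow> T \<subseteq> {0..1} \<longrightarrow> (\<Sum>I\<in>D. measure lborel I) < \<delta> \<longrightarrow>
        (\<Sum>I\<in>D. dist (x (Inf I)) (x (Sup I))) < e"
      using e M by (intro exI[of _ "(e / M)\<^sup>2"]) auto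
  qed
  show "AE s in lebesgue_on {0..1}. (x has_vector_derivative (\<Sum>i\<in>UNIV. u s $ i *\<^sub>R F i (x s))) (at s within {0..1})"
    unfolding velocity_def[symmetric]
  proof (subst AE_lebesgue_on_iff_negligible)
    have "(x has_vector_derivative velocity (u s) (x s)) (at s within {0..1})"
      if s: "s \<in> {0..1}" and der: "((\<lambda>t. integral {0..t} (\<lambda>s. velocity (u s) (x s))) has_vector_derivative velocity (u s) (x s)) (at s within {0..1})" for s
    proof (rule has_vector_derivative_transform[OF s])
      show "((\<lambda>t. x0 + integral {0..t} (\<lambda>s. velocity (u s) (x s))) has_vector_derivative velocity (u s) (x s)) (at s within {0..1})"
        using has_vector_derivative_add[OF has_vector_derivative_const der, of x0] by simp
    qed (use eq in simp)
    then show "negligible {s \<in> {0..1}. \<not> (x has_vector_derivative velocity (u s) (x s)) (at s within {0..1})}"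
      by (intro negligible_subset[OF lebesgue_differentiation_indefinite_integral[OF velocity_integrable[OF u xc order_refl]]]) blast
  qed simp
qed

lemma caratheodory_imp_integral_solution:
  assumes u: "u \<in> L2_controls" and x: "caratheodory_solution F u x0 x"
  shows "integral_solution u x0 x"
proof -
  have ac: "abs_continuous_on {0..1} x" and x0: "x 0 = x0"
    and ae: "AE s in lebesgue_on {0..1}. (x has_vector_derivative velocity (u s) (x s)) (at s within {0..1})"
    using x by (auto simp: caratheodory_solution_def velocity_def)
  define N where "N = {s \<in> {0..1}. \<not> (x has_vector_derivative velocity (u s) (x s)) (at s within {0..1})}"
  have N: "negligible N"
    using ae by (simp add: N_def AE_lebesgue_on_iff_negligible)
  have "x t = x0 + integral {0..t} (\<lambda>s. velocity (u s) (x s))" if t: "t \<in> {0..1}" for t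
  proof -
    have sub: "{0..t} \<subseteq> {0..1}" using t by auto
    have "((\<lambda>s. velocity (u s) (x s)) has_integral (x t - x 0)) {0..t}"
    proof (rule has_integral_abs_continuous[OF _ abs_continuous_on_subset[OF ac sub] N])
      show "(x has_vector_derivative velocity (u s) (x s)) (at s within {0..t})" if "s \<in> {0..t} - N" for s
        by (rule has_vector_derivative_within_subset[OF _ sub]) (use that sub in \<open>auto simp: N_def\<close>)
    qed (use t in simp)
    then show ?thesis using x0 by (simp add: integral_unique)
  qed
  then show ?thesis
    using abs_continuous_on_imp_continuous_on[OF ac] by (simp add: integral_solution_def)
qed

lemma integral_solution_cong:
  assumes "integral_solution u x0 x" "\<And>t. t \<in> {0..1} \<Longrightarrow> x t = y t"
  shows "integral_solution u x0 y"
proof -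
  have "integral {0..t} (\<lambda>s. velocity (u s) (x s)) = integral {0..t} (\<lambda>s. velocity (u s) (y s))" if "t \<in> {0..1}" for t
    using that assms(2) by (intro integral_cong) auto
  then show ?thesis
    using assms continuous_on_cong[of "{0..1}" "{0..1}" x y] by (simp add: integral_solution_def)
qed

text \<open>
  Caratheodory solutions restricted to the unit interval are exactly the restricted solutions of
  the integral equation, and there is only one; hence the definite description in the definition
  of the trajectory denotes it.
\<close>

lemma flow_eq_integral_solution:
  assumes u: "u \<in> L2_controls" and x: "integral_solution u x0 x"
  shows "flow F u x0 = x 1"
proof -
  have "trajectory F u x0 = restrict x {0..1}"
    unfolding trajectory_def
  proof (rule the_equality)
    have "integral_solution u x0 (restrict x {0..1})"
      by (rule integral_solution_cong[OF x]) simp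
    then show "restrict x {0..1} \<in> extensional {0..1} \<and> caratheodory_solution F u x0 (restrict x {0..1})"
      by (simp add: integral_solution_imp_caratheodory u)
  next
    fix y assume y: "y \<in> extensional {0..1} \<and> caratheodory_solution F u x0 y"
    then have "integral_solution u x0 y" by (simp add: caratheodory_imp_integral_solution u)
    then have "y t = x t" if "t \<in> {0..1}" for t
      using integral_solution_unique[OF u _ x that] by blast
    then show "y = restrict x {0..1}"
      using y by (intro extensionalityI[of _ "{0..1}"]) auto
  qed
  then show ?thesis by (simp add: flow_def)
qed

end

section \<open>Limits of square-integrable controls\<close>

text \<open>
  The sum of the norms of the increments is integrable, hence finite almost everywhere, so the
  telescoping series converges there and may be integrated term by term.
\<close>

lemma fast_L1_cauchy_limit:
  fixes w :: "nat \<Rightarrow> 'a \<Rightarrow> 'b::{banach,second_countable_topology}"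
  assumes int[measurable]: "\<And>n. integrable M (w n)"
    and fast: "\<And>n. (\<integral>x. norm (w (Suc n) x - w n x) \<partial>M) \<le> (1/2)^n"
  shows "AE x in M. (\<lambda>n. w n x) \<longlonglongrightarrow> lim (\<lambda>n. w n x)"
    and "(\<lambda>n. \<integral>x. w n x \<partial>M) \<longlonglongrightarrow> (\<integral>x. lim (\<lambda>n. w n x) \<partial>M)"
proof -
  define f where "f n x = w (Suc n) x - w n x" for n x
  have f_int[measurable]: "integrable M (f n)" for n unfolding f_def by (intro Bochner_Integration.integrable_diff int)
  have w_meas[measurable]: "w n \<in> borel_measurable M" "f n \<in> borel_measurable M" for n
    using int[of n] f_int[of n] by (auto intro: borel_measurable_integrable)
  have sum_int: "summable (\<lambda>n. \<integral>x. norm (f n x) \<partial>M)"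
    by (rule summable_comparison_test'[of "\<lambda>n. (1/2)^n"]) (use fast in \<open>auto simp: f_def summable_geometric\<close>)
  have "(\<integral>\<^sup>+x. (\<Sum>n. ennreal (norm (f n x))) \<partial>M) = (\<Sum>n. \<integral>\<^sup>+x. ennreal (norm (f n x)) \<partial>M)"
    by (rule nn_integral_suminf) measurable
  also have "\<dots> = (\<Sum>n. ennreal (\<integral>x. norm (f n x) \<partial>M))"
    by (intro suminf_cong nn_integral_eq_integral integrable_norm f_int) simp
  also have "\<dots> = ennreal (\<Sum>n. \<integral>x. norm (f n x) \<partial>M)"
    by (rule suminf_ennreal_eq[OF _ summable_sums[OF sum_int]]) (auto intro: Bochner_Integration.integral_nonneg)
  finally have "(\<integral>\<^sup>+x. (\<Sum>n. ennreal (norm (f n x))) \<partial>M) \<noteq> \<infinity>" by simp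
  then have "AE x in M. (\<Sum>n. ennreal (norm (f n x))) \<noteq> \<infinity>"
    by (intro nn_integral_PInf_AE) measurable
  then have summ: "AE x in M. summable (\<lambda>n. norm (f n x))"
    by eventually_elim (auto intro: summable_suminf_not_top)
  have tele: "(\<Sum>i<n. f i x) = w n x - w 0 x" for n x
    unfolding f_def by (rule sum_lessThan_telescope)
  have conv: "AE x in M. (\<lambda>n. w n x) \<longlonglongrightarrow> w 0 x + (\<Sum>n. f n x)"
    using summ
  proof eventually_elim
    case (elim x)
    then have "(\<lambda>n. \<Sum>i<n. f i x) \<longlonglongrightarrow> (\<Sum>n. f n x)"
      by (rule summable_LIMSEQ[OF summable_norm_cancel])
    then have "(\<lambda>n. w 0 x + (\<Sum>i<n. f i x)) \<longlonglongrightarrow> w 0 x + (\<Sum>n. f n x)"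
      by (intro tendsto_add tendsto_const)
    then show ?case by (simp add: tele)
  qed
  then show "AE x in M. (\<lambda>n. w n x) \<longlonglongrightarrow> lim (\<lambda>n. w n x)"
    by eventually_elim (simp add: limI)
  have eq: "AE x in M. lim (\<lambda>n. w n x) = w 0 x + (\<Sum>n. f n x)"
    using conv by eventually_elim (rule limI)
  have "(\<lambda>n. \<integral>x. f n x \<partial>M) sums (\<integral>x. (\<Sum>n. f n x) \<partial>M)"
    by (rule sums_integral[OF f_int summ sum_int])
  then have "(\<lambda>n. (\<integral>x. w 0 x \<partial>M) + (\<Sum>i<n. \<integral>x. f i x \<partial>M)) \<longlonglongrightarrow> (\<integral>x. w 0 x \<partial>M) + (\<integral>x. (\<Sum>n. f n x) \<partial>M)"
    unfolding sums_def by (intro tendsto_add tendsto_const)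
  moreover have "(\<integral>x. w 0 x \<partial>M) + (\<Sum>i<n. \<integral>x. f i x \<partial>M) = (\<integral>x. w n x \<partial>M)" for n
    by (subst Bochner_Integration.integral_sum[symmetric]) (simp_all add: f_int tele int)
  moreover have "(\<integral>x. w 0 x \<partial>M) + (\<integral>x. (\<Sum>n. f n x) \<partial>M) = (\<integral>x. w 0 x + (\<Sum>n. f n x) \<partial>M)"
    by (rule Bochner_Integration.integral_add[symmetric, OF int integrable_suminf[OF f_int summ sum_int]])
  moreover have "\<dots> = (\<integral>x. lim (\<lambda>n. w n x) \<partial>M)"
    using eq by (intro integral_cong_AE) (measurable, auto)
  ultimately show "(\<lambda>n. \<integral>x. w n x \<partial>M) \<longlonglongrightarrow> (\<integral>x. lim (\<lambda>n. w n x) \<partial>M)" by simp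
qed

lemma L2_controls_linear_combination:
  fixes u v :: "real \<Rightarrow> 'a::euclidean_space"
  assumes u: "u \<in> L2_controls" and v: "v \<in> L2_controls"
  shows "(\<lambda>s. a *\<^sub>R u s + b *\<^sub>R v s) \<in> L2_controls"
proof (rule L2_controlsI)
  have [measurable]: "u \<in> borel_measurable (lebesgue_on {0..1})" "v \<in> borel_measurable (lebesgue_on {0..1})"
    using u v by (auto intro: L2_controls_measurable)
  show "(\<lambda>s. a *\<^sub>R u s + b *\<^sub>R v s) \<in> borel_measurable (lebesgue_on {0..1})" by measurable
  show "(\<lambda>s. 2 * a\<^sup>2 * (norm (u s))\<^sup>2 + 2 * b\<^sup>2 * (norm (v s))\<^sup>2) integrable_on {0..1}"
    by (intro integrable_add integrable_on_mult_right L2_controls_square_integrable u v)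
  show "(norm (a *\<^sub>R u s + b *\<^sub>R v s))\<^sup>2 \<le> 2 * a\<^sup>2 * (norm (u s))\<^sup>2 + 2 * b\<^sup>2 * (norm (v s))\<^sup>2" for s
  proof -
    have "(norm (a *\<^sub>R u s + b *\<^sub>R v s))\<^sup>2 + (norm (a *\<^sub>R u s - b *\<^sub>R v s))\<^sup>2
       = 2 * (norm (a *\<^sub>R u s))\<^sup>2 + 2 * (norm (b *\<^sub>R v s))\<^sup>2"
      unfolding power2_norm_eq_inner by (simp add: inner_commute algebra_simps)
    then have "(norm (a *\<^sub>R u s + b *\<^sub>R v s))\<^sup>2 \<le> 2 * (norm (a *\<^sub>R u s))\<^sup>2 + 2 * (norm (b *\<^sub>R v s))\<^sup>2"
      using zero_le_power2[of "norm (a *\<^sub>R u s - b *\<^sub>R v s)"] by linarith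
    then show ?thesis by (simp add: power_mult_distrib mult.assoc)
  qed
qed

lemma L2_controls_diff: "u \<in> L2_controls \<Longrightarrow> v \<in> L2_controls \<Longrightarrow> (\<lambda>s. u s - v s) \<in> L2_controls"
  using L2_controls_linear_combination[of u v 1 "-1"] by simp

lemma L2_control_norm_square:
  "u \<in> L2_controls \<Longrightarrow> (L2_control_norm u)\<^sup>2 = integral {0..1} (\<lambda>s. (norm (u s))\<^sup>2)"
  unfolding L2_control_norm_eq_integral
  by (intro real_sqrt_pow2 Henstock_Kurzweil_Integration.integral_nonneg L2_controls_square_integrable) auto

lemma L2_control_parallelogram:
  assumes u: "u \<in> L2_controls" and v: "v \<in> L2_controls"
  shows "(L2_control_norm (\<lambda>s. u s - v s))\<^sup>2 =
    2 * (L2_control_norm u)\<^sup>2 + 2 * (L2_control_norm v)\<^sup>2 - 4 * (L2_control_norm (\<lambda>s. (1/2) *\<^sub>R u s + (1/2) *\<^sub>R v s))\<^sup>2"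
proof -
  have m: "(\<lambda>s. (1/2) *\<^sub>R u s + (1/2) *\<^sub>R v s) \<in> L2_controls" by (rule L2_controls_linear_combination[OF u v])
  have "((\<lambda>s. 2 * (norm (u s))\<^sup>2 + 2 * (norm (v s))\<^sup>2 - 4 * (norm ((1/2) *\<^sub>R u s + (1/2) *\<^sub>R v s))\<^sup>2) has_integral
    2 * (L2_control_norm u)\<^sup>2 + 2 * (L2_control_norm v)\<^sup>2 - 4 * (L2_control_norm (\<lambda>s. (1/2) *\<^sub>R u s + (1/2) *\<^sub>R v s))\<^sup>2) {0..1}"
    unfolding L2_control_norm_square[OF u] L2_control_norm_square[OF v] L2_control_norm_square[OF m]
    by (intro has_integral_add has_integral_diff has_integral_mult_right integrable_integral
        L2_controls_square_integrable u v m)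
  moreover have "2 * (norm (u s))\<^sup>2 + 2 * (norm (v s))\<^sup>2 - 4 * (norm ((1/2) *\<^sub>R u s + (1/2) *\<^sub>R v s))\<^sup>2 = (norm (u s - v s))\<^sup>2" for s
    unfolding power2_norm_eq_inner by (simp add: inner_commute algebra_simps)
  ultimately show ?thesis
    unfolding L2_control_norm_square[OF L2_controls_diff[OF u v]] by (simp add: integral_unique)
qed

lemma L2_controls_interval_integral_le:
  assumes u: "u \<in> L2_controls" and ab: "a \<le> b" "{a..b} \<subseteq> {0..1}"
  shows "integral {a..b} (\<lambda>s. norm (u s)) \<le> L2_control_norm u * sqrt (b - a)"
proof -
  have "{{a..b}} division_of {a..b}" using division_of_self[of a b] ab by simp
  from L2_controls_division_sum_le[OF u this ab(2)] show ?thesis using ab by simp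
qed

lemma L2_controls_integrable_subinterval:
  assumes u: "u \<in> L2_controls" and ab: "{a..b} \<subseteq> {0..1}"
  shows "u integrable_on {a..b}" "(\<lambda>s. norm (u s)) integrable_on {a..b}"
proof -
  have "u absolutely_integrable_on {0..1}" by (rule L2_controls_absolutely_integrable[OF u])
  then show "u integrable_on {a..b}" "(\<lambda>s. norm (u s)) integrable_on {a..b}"
    unfolding absolutely_integrable_on_def using integrable_on_subinterval[OF _ ab] by blast+
qed

lemma norm_L2_control_integral_le:
  assumes u: "u \<in> L2_controls" and ab: "a \<le> b" "{a..b} \<subseteq> {0..1}"
  shows "norm (integral {a..b} u) \<le> L2_control_norm u * sqrt (b - a)"
proof -
  have "norm (integral {a..b} u) \<le> integral {a..b} (\<lambda>s. norm (u s))"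
    using L2_controls_integrable_subinterval[OF u ab(2)] by (intro integral_norm_bound_integral) auto
  then show ?thesis using L2_controls_interval_integral_le[OF u ab] by linarith
qed

text \<open>
  The \<open>L\<^sup>2\<close> bounds on the increments are \<open>L\<^sup>1\<close> bounds on the unit interval, which give an almost
  everywhere limit. Fatou's lemma shows that the limit is square-integrable.
\<close>

lemma L2_controls_fast_cauchy_limit:
  fixes w :: "nat \<Rightarrow> real \<Rightarrow> 'a::euclidean_space"
  assumes w: "\<And>n. w n \<in> L2_controls"
    and B: "\<And>n. L2_control_norm (w n) \<le> B"
    and fast: "\<And>n. L2_control_norm (\<lambda>s. w (Suc n) s - w n s) \<le> (1/2)^n"
  obtains v where "v \<in> L2_controls"
    "\<And>t. t \<in> {0..1} \<Longrightarrow> (\<lambda>n. integral {0..t} (w n)) \<longlonglongrightarrow> integral {0..t} v"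
proof -
  define v where "v s = lim (\<lambda>n. w n s)" for s
  have int: "integrable (lebesgue_on {0..t}) (w n)" if t: "t \<in> {0..1}" for n t
  proof -
    have "w n absolutely_integrable_on {0..t}"
      by (rule absolutely_integrable_on_subinterval[OF L2_controls_absolutely_integrable[OF w]]) (use t in auto)
    then show ?thesis by (simp add: integrable_restrict_space set_integrable_def)
  qed
  have L1: "(\<integral>s. norm (w (Suc n) s - w n s) \<partial>lebesgue_on {0..t}) \<le> (1/2)^n" if t: "t \<in> {0..1}" for n t
  proof -
    have "(\<integral>s. norm (w (Suc n) s - w n s) \<partial>lebesgue_on {0..t}) = integral {0..t} (\<lambda>s. norm (w (Suc n) s - w n s))"
      by (intro lebesgue_integral_eq_integral integrable_norm Bochner_Integration.integrable_diff int t) simp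
    also have "\<dots> \<le> L2_control_norm (\<lambda>s. w (Suc n) s - w n s) * sqrt (t - 0)"
      using t by (intro L2_controls_interval_integral_le L2_controls_diff w) auto
    also have "\<dots> \<le> (1/2)^n * 1"
      using t by (intro mult_mono fast) auto
    finally show ?thesis by simp
  qed
  have one: "(1::real) \<in> {0..1}" by simp
  have ae: "AE s in lebesgue_on {0..1}. (\<lambda>n. w n s) \<longlonglongrightarrow> v s"
    unfolding v_def by (rule fast_L1_cauchy_limit(1)[OF int[OF one] L1[OF one]])
  have [measurable]: "w n \<in> borel_measurable (lebesgue_on {0..1})" for n
    by (rule L2_controls_measurable[OF w])
  have v_meas[measurable]: "v \<in> borel_measurable (lebesgue_on {0..1})"
    unfolding v_def by measurable
  have sq: "(\<integral>\<^sup>+s. ennreal ((norm (w n s))\<^sup>2) \<partial>lebesgue_on {0..1}) \<le> ennreal (B\<^sup>2)" for n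
  proof -
    have i: "integrable (lebesgue_on {0..1}) (\<lambda>s. (norm (w n s))\<^sup>2)"
      using w[of n] by (simp add: L2_controls_def)
    have "(\<integral>\<^sup>+s. ennreal ((norm (w n s))\<^sup>2) \<partial>lebesgue_on {0..1}) = ennreal (\<integral>s. (norm (w n s))\<^sup>2 \<partial>lebesgue_on {0..1})"
      by (rule nn_integral_eq_integral[OF i]) simp
    also have "(\<integral>s. (norm (w n s))\<^sup>2 \<partial>lebesgue_on {0..1}) = (L2_control_norm (w n))\<^sup>2"
      using L2_control_norm_square[OF w[of n]] i by (simp add: lebesgue_integral_eq_integral)
    also have "\<dots> \<le> B\<^sup>2" by (intro power_mono B L2_control_norm_nonneg)
    finally show ?thesis by (simp add: ennreal_leI)
  qed
  have "(\<integral>\<^sup>+s. ennreal ((norm (v s))\<^sup>2) \<partial>lebesgue_on {0..1}) = (\<integral>\<^sup>+s. liminf (\<lambda>n. ennreal ((norm (w n s))\<^sup>2)) \<partial>lebesgue_on {0..1})"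
  proof (rule nn_integral_cong_AE)
    show "AE s in lebesgue_on {0..1}. ennreal ((norm (v s))\<^sup>2) = liminf (\<lambda>n. ennreal ((norm (w n s))\<^sup>2))"
      using ae
    proof eventually_elim
      case (elim s)
      then have "(\<lambda>n. ennreal ((norm (w n s))\<^sup>2)) \<longlonglongrightarrow> ennreal ((norm (v s))\<^sup>2)"
        by (intro tendsto_ennrealI tendsto_intros)
      then show ?case by (rule lim_imp_Liminf[OF sequentially_bot, symmetric])
    qed
  qed
  also have "\<dots> \<le> liminf (\<lambda>n. \<integral>\<^sup>+s. ennreal ((norm (w n s))\<^sup>2) \<partial>lebesgue_on {0..1})"
    by (rule nn_integral_liminf) measurable
  also have "\<dots> \<le> liminf (\<lambda>n. ennreal (B\<^sup>2))"
    by (intro Liminf_mono always_eventually allI sq)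
  also have "\<dots> = ennreal (B\<^sup>2)" by (rule Liminf_const) simp
  finally have "(\<integral>\<^sup>+s. ennreal ((norm (v s))\<^sup>2) \<partial>lebesgue_on {0..1}) < \<infinity>"
    by (rule le_less_trans) simp
  moreover have "(\<lambda>s. (norm (v s))\<^sup>2) \<in> borel_measurable (lebesgue_on {0..1})" by measurable
  ultimately have "integrable (lebesgue_on {0..1}) (\<lambda>s. (norm (v s))\<^sup>2)"
    by (intro integrableI_bounded) simp_all
  then have v: "v \<in> L2_controls" using v_meas by (simp add: L2_controls_def)
  have "(\<lambda>n. integral {0..t} (w n)) \<longlonglongrightarrow> integral {0..t} v" if t: "t \<in> {0..1}" for t
  proof -
    have "v absolutely_integrable_on {0..t}"
      by (rule absolutely_integrable_on_subinterval[OF L2_controls_absolutely_integrable[OF v]]) (use t in auto)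
    then have "integrable (lebesgue_on {0..t}) v" by (simp add: integrable_restrict_space set_integrable_def)
    then have "integral\<^sup>L (lebesgue_on {0..t}) v = integral {0..t} v" by (rule lebesgue_integral_eq_integral) simp
    moreover have "integral\<^sup>L (lebesgue_on {0..t}) (w n) = integral {0..t} (w n)" for n
      by (rule lebesgue_integral_eq_integral[OF int[OF t]]) simp
    ultimately show ?thesis
      using fast_L1_cauchy_limit(2)[OF int[OF t] L1[OF t], folded v_def] by simp
  qed
  with v show thesis by (rule that)
qed

section \<open>Weak compactness of bounded sets of controls\<close>

text \<open>
  The controls whose primitive is within a tolerance of \<open>U\<close> form a convex set. As the tolerance
  decreases, the infimum of the squared norm over these sets increases and is at most \<open>M\<^sup>2\<close>, so it
  converges. Midpoints of almost minimal elements stay in the set, so they are not much shorter,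
  and the parallelogram law makes almost minimal elements a Cauchy sequence. This replaces weak
  limits in \<open>L\<^sup>2\<close> by a strong limit of other controls.
\<close>

lemma L2_primitive_in_closure:
  fixes U :: "real \<Rightarrow> 'a::euclidean_space"
  assumes approx: "\<And>\<epsilon>. \<epsilon> > 0 \<Longrightarrow> \<exists>v\<in>L2_controls. L2_control_norm v \<le> M \<and> (\<forall>t\<in>{0..1}. norm (integral {0..t} v - U t) \<le> \<epsilon>)"
  obtains v where "v \<in> L2_controls" "\<And>t. t \<in> {0..1} \<Longrightarrow> integral {0..t} v = U t"
proof -
  define A where "A n = {v \<in> L2_controls. \<forall>t\<in>{0..1}. norm (integral {0..t} v - U t) \<le> 1 / real (Suc n)}" for n
  define d where "d n = Inf ((\<lambda>v. (L2_control_norm v)\<^sup>2) ` A n)" for n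
  have A_approx: "\<exists>v\<in>A n. L2_control_norm v \<le> M" for n
    using approx[of "1 / real (Suc n)"] by (auto simp: A_def)
  have A_mono: "A n \<subseteq> A m" if "m \<le> n" for m n
  proof -
    have "1 / real (Suc n) \<le> 1 / real (Suc m)" using that by (simp add: field_simps)
    then show ?thesis unfolding A_def by (fastforce intro: order_trans)
  qed
  have bdd: "bdd_below ((\<lambda>v. (L2_control_norm v)\<^sup>2) ` A n)" for n
    by (rule bdd_belowI[of _ 0]) auto
  have d_le: "d n \<le> (L2_control_norm v)\<^sup>2" if "v \<in> A n" for n v
    unfolding d_def using bdd that by (intro cInf_lower) auto
  have "d n \<le> M\<^sup>2" for n
  proof -
    obtain v where v: "v \<in> A n" "L2_control_norm v \<le> M" using A_approx by blast
    have "d n \<le> (L2_control_norm v)\<^sup>2" by (rule d_le[OF v(1)])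
    also have "\<dots> \<le> M\<^sup>2" by (intro power_mono v L2_control_norm_nonneg)
    finally show ?thesis .
  qed
  moreover have "incseq d"
    unfolding d_def by (intro incseq_SucI cInf_superset_mono bdd image_mono A_mono) (use A_approx in blast, simp)
  ultimately obtain D where D: "d \<longlonglongrightarrow> D" "\<And>n. d n \<le> D"
    using incseq_convergent by metis
  have "\<exists>v\<in>A n. (L2_control_norm v)\<^sup>2 < d n + 1 / real (Suc n)" for n
  proof -
    have "\<exists>q\<in>(\<lambda>v. (L2_control_norm v)\<^sup>2) ` A n. q < d n + 1 / real (Suc n)"
      using A_approx[of n] unfolding d_def by (intro cInf_lessD) auto
    then show ?thesis by blast
  qed
  then obtain v where v: "\<And>n. v n \<in> A n" "\<And>n. (L2_control_norm (v n))\<^sup>2 < d n + 1 / real (Suc n)"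
    by metis
  have v_L2: "v n \<in> L2_controls" for n using v(1)[of n] by (simp add: A_def)
  \<comment> \<open>The parallelogram law with both norms almost minimal gives \<open>2 (d n + \<epsilon>) + 2 (D + \<epsilon>) - 4 d n\<close> for \<open>\<epsilon> = 1 / Suc n\<close>.\<close>
  define \<eta> where "\<eta> n = 2 * (D - d n) + 4 * (1 / real (Suc n))" for n
  have \<eta>_lim: "\<eta> \<longlonglongrightarrow> 0"
  proof -
    have "\<eta> \<longlonglongrightarrow> 2 * (D - D) + 4 * 0"
      unfolding \<eta>_def by (intro tendsto_intros D LIMSEQ_Suc[OF lim_1_over_n])
    then show ?thesis by simp
  qed
  have cauchy: "(L2_control_norm (\<lambda>s. v m s - v n s))\<^sup>2 \<le> \<eta> n" if "n \<le> m" for n m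
  proof -
    define w where "w = (\<lambda>s. (1/2) *\<^sub>R v m s + (1/2) *\<^sub>R v n s)"
    have vA: "v m \<in> A n" "v n \<in> A n" using A_mono[OF that] v(1) by auto
    have "norm (integral {0..t} w - U t) \<le> 1 / real (Suc n)" if t: "t \<in> {0..1}" for t
    proof -
      have sub: "{0..t} \<subseteq> {0..1}" using t by auto
      have "integral {0..t} w = (1/2) *\<^sub>R integral {0..t} (v m) + (1/2) *\<^sub>R integral {0..t} (v n)"
        unfolding w_def
        by (intro integral_unique has_integral_add has_integral_cmul integrable_integral
            L2_controls_integrable_subinterval v_L2 sub)
      then have "integral {0..t} w - U t = (1/2) *\<^sub>R (integral {0..t} (v m) - U t) + (1/2) *\<^sub>R (integral {0..t} (v n) - U t)"
        by (simp add: algebra_simps flip: scaleR_add_left)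
      also have "norm \<dots> \<le> (1/2) * (1 / real (Suc n)) + (1/2) * (1 / real (Suc n))"
      proof (intro norm_triangle_mono)
        have half: "norm ((1/2) *\<^sub>R (integral {0..t} z - U t)) \<le> (1/2) * (1 / real (Suc n))" if "z \<in> A n" for z
        proof -
          have "norm (integral {0..t} z - U t) \<le> 1 / real (Suc n)" using that t by (simp add: A_def)
          then show ?thesis unfolding norm_scaleR by (intro mult_mono) auto
        qed
        show "norm ((1/2) *\<^sub>R (integral {0..t} (v m) - U t)) \<le> (1/2) * (1 / real (Suc n))"
          "norm ((1/2) *\<^sub>R (integral {0..t} (v n) - U t)) \<le> (1/2) * (1 / real (Suc n))"
          by (intro half vA)+
      qed
      also have "(1/2) * (1 / real (Suc n)) + (1/2) * (1 / real (Suc n)) = 1 / real (Suc n)" by linarith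
      finally show ?thesis .
    qed
    then have "w \<in> A n"
      unfolding A_def using L2_controls_linear_combination[OF v_L2 v_L2] by (simp add: w_def)
    then have "d n \<le> (L2_control_norm w)\<^sup>2" by (rule d_le)
    moreover have "1 / real (Suc m) \<le> 1 / real (Suc n)" using that by (simp add: field_simps)
    moreover define p q where "p = 1 / real (Suc m)" and "q = 1 / real (Suc n)"
    ultimately show ?thesis
      using L2_control_parallelogram[OF v_L2[of m] v_L2[of n]] v(2)[of n] v(2)[of m] D(2)[of m]
      unfolding w_def[symmetric] \<eta>_def p_def[symmetric] q_def[symmetric] by argo
  qed
  have "\<exists>N. \<forall>n\<ge>N. \<eta> n < ((1/2)^j)\<^sup>2" for j :: nat
    using order_tendstoD(2)[OF \<eta>_lim, of "((1/2)^j)\<^sup>2"] by (simp add: eventually_sequentially)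
  then obtain N where N: "\<And>j n. n \<ge> N j \<Longrightarrow> \<eta> n < ((1/2)^j)\<^sup>2" by metis
  \<comment> \<open>Summing makes the indices monotone; adding \<open>j\<close> makes them unbounded.\<close>
  define I where "I j = j + (\<Sum>i\<le>j. N i)" for j :: nat
  have I: "N j \<le> I j" "j \<le> I j" "I j \<le> I (Suc j)" for j
    unfolding I_def using member_le_sum[of j "{..j}" N] by auto
  define w where "w j = v (I j)" for j
  have fast: "L2_control_norm (\<lambda>s. w (Suc j) s - w j s) \<le> (1/2)^j" for j
  proof -
    have "(L2_control_norm (\<lambda>s. w (Suc j) s - w j s))\<^sup>2 \<le> ((1/2)^j)\<^sup>2"
      using cauchy[OF I(3)[of j]] N[OF I(1)[of j]] by (simp add: w_def)
    then show ?thesis by (rule power2_le_imp_le) simp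
  qed
  have bounded: "L2_control_norm (w j) \<le> sqrt (D + 1)" for j
  proof (rule real_le_rsqrt)
    have "1 / real (Suc (I j)) \<le> 1" by simp
    then show "(L2_control_norm (w j))\<^sup>2 \<le> D + 1"
      using v(2)[of "I j"] D(2)[of "I j"] unfolding w_def by linarith
  qed
  obtain z where z: "z \<in> L2_controls" "\<And>t. t \<in> {0..1} \<Longrightarrow> (\<lambda>j. integral {0..t} (w j)) \<longlonglongrightarrow> integral {0..t} z"
    using L2_controls_fast_cauchy_limit[OF _ bounded fast] v_L2 unfolding w_def by metis
  have "integral {0..t} z = U t" if t: "t \<in> {0..1}" for t
  proof (rule LIMSEQ_unique[OF z(2)[OF t]])
    have le: "norm (integral {0..t} (w j) - U t) \<le> 1 / real (Suc j)" for j
    proof -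
      have "v (I j) \<in> A j" using A_mono[OF I(2)] v(1) by blast
      then show ?thesis using t by (simp add: A_def w_def)
    qed
    have "(\<lambda>j. integral {0..t} (w j) - U t) \<longlonglongrightarrow> 0"
      by (rule Lim_null_comparison[OF always_eventually[OF allI[OF le]] LIMSEQ_Suc[OF lim_1_over_n]])
    then show "(\<lambda>j. integral {0..t} (w j)) \<longlonglongrightarrow> U t" by (simp add: LIM_zero_iff)
  qed
  with z(1) show thesis by (rule that)
qed

theorem L2_bounded_controls_weakly_compact:
  fixes u :: "nat \<Rightarrow> real \<Rightarrow> 'a::euclidean_space"
  assumes u: "\<And>k. u k \<in> L2_controls" and M: "\<And>k. L2_control_norm (u k) \<le> M"
  obtains v r where "v \<in> L2_controls" "strict_mono (r :: nat \<Rightarrow> nat)"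
    "uniform_limit {0..1} (\<lambda>k t. integral {0..t} (u (r k))) (\<lambda>t. integral {0..t} v) sequentially"
proof -
  have M0: "M \<ge> 0" using M[of 0] L2_control_norm_nonneg[of "u 0"] by linarith
  have holder: "norm (integral {0..s} (u k) - integral {0..t} (u k)) \<le> M * sqrt \<bar>s - t\<bar>"
    if "s \<in> {0..1}" "t \<in> {0..1}" for k s t
  proof -
    have *: "norm (integral {0..b} (u k) - integral {0..a} (u k)) \<le> M * sqrt (b - a)"
      if ab: "a \<in> {0..1}" "b \<in> {0..1}" "a \<le> b" for a b
    proof -
      have "integral {0..a} (u k) + integral {a..b} (u k) = integral {0..b} (u k)"
        using ab by (intro Henstock_Kurzweil_Integration.integral_combine L2_controls_integrable_subinterval u) auto
      then have "norm (integral {0..b} (u k) - integral {0..a} (u k)) = norm (integral {a..b} (u k))"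
        by (metis add_diff_cancel_left')
      also have "\<dots> \<le> L2_control_norm (u k) * sqrt (b - a)"
        using ab by (intro norm_L2_control_integral_le u) auto
      also have "\<dots> \<le> M * sqrt (b - a)" using ab by (intro mult_right_mono M) auto
      finally show ?thesis .
    qed
    show ?thesis
      using *[of s t] *[of t s] that by (cases "s \<le> t") (auto simp: norm_minus_commute)
  qed
  obtain U r where r: "strict_mono (r :: nat \<Rightarrow> nat)"
    and lim: "\<And>e. 0 < e \<Longrightarrow> \<exists>N. \<forall>n x. n \<ge> N \<and> x \<in> {0..1} \<longrightarrow> norm (integral {0..x} (u (r n)) - U x) < e"
  proof (rule Arzela_Ascoli[of "{0..1::real}" "\<lambda>k t. integral {0..t} (u k)" M])
    show "norm (integral {0..t} (u k)) \<le> M" if t: "t \<in> {0..1}" for k t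
    proof -
      have "norm (integral {0..t} (u k)) \<le> M * sqrt \<bar>t - 0\<bar>" using holder[of t 0 k] t by simp
      also have "\<dots> \<le> M * 1" using t M0 by (intro mult_left_mono) auto
      finally show ?thesis by simp
    qed
    show "\<exists>d>0. \<forall>k t. t \<in> {0..1} \<and> norm (s - t) < d \<longrightarrow> norm (integral {0..s} (u k) - integral {0..t} (u k)) < e"
      if s: "s \<in> {0..1}" and e: "0 < e" for s e :: real
    proof (intro exI[of _ "(e / (M + 1))\<^sup>2"] conjI allI impI)
      show "(e / (M + 1))\<^sup>2 > 0" using e M0 by simp
      fix k t assume t: "t \<in> {0..1} \<and> norm (s - t) < (e / (M + 1))\<^sup>2"
      have "sqrt \<bar>s - t\<bar> < sqrt ((e / (M + 1))\<^sup>2)" using t by (intro real_sqrt_less_mono) simp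
      then have lt: "sqrt \<bar>s - t\<bar> < e / (M + 1)" using e M0 by simp
      have "norm (integral {0..s} (u k) - integral {0..t} (u k)) \<le> M * sqrt \<bar>s - t\<bar>"
        using holder s t by blast
      also have "\<dots> \<le> (M + 1) * sqrt \<bar>s - t\<bar>" by (intro mult_right_mono) auto
      also have "\<dots> < (M + 1) * (e / (M + 1))" using lt M0 by (intro mult_strict_left_mono) auto
      finally show "norm (integral {0..s} (u k) - integral {0..t} (u k)) < e" using M0 by simp
    qed
  qed auto
  obtain v where v: "v \<in> L2_controls" "\<And>t. t \<in> {0..1} \<Longrightarrow> integral {0..t} v = U t"
  proof (rule L2_primitive_in_closure[of M U])
    fix e :: real assume "e > 0"
    then obtain N where "\<forall>n x. n \<ge> N \<and> x \<in> {0..1} \<longrightarrow> norm (integral {0..x} (u (r n)) - U x) < e"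
      using lim by blast
    then show "\<exists>v\<in>L2_controls. L2_control_norm v \<le> M \<and> (\<forall>t\<in>{0..1}. norm (integral {0..t} v - U t) \<le> e)"
      using u M by (intro bexI[of _ "u (r N)"]) (auto intro: less_imp_le)
  qed blast
  have "uniform_limit {0..1} (\<lambda>k t. integral {0..t} (u (r k))) (\<lambda>t. integral {0..t} v) sequentially"
    unfolding uniform_limit_sequentially_iff dist_norm
  proof (intro allI impI)
    fix e :: real assume "e > 0"
    then obtain N where "\<forall>n x. n \<ge> N \<and> x \<in> {0..1} \<longrightarrow> norm (integral {0..x} (u (r n)) - U x) < e"
      using lim by blast
    then show "\<exists>N. \<forall>n\<ge>N. \<forall>t\<in>{0..1}. norm (integral {0..t} (u (r n)) - integral {0..t} v) < e"
      using v(2) by (intro exI[of _ N]) auto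
  qed
  with v(1) r show thesis by (rule that)
qed

section \<open>Weak continuity of the flow\<close>

context control_system
begin

text \<open>
  On an interval where \<open>y\<close> is nearly constant, the integral sees the control almost only through
  its increment \<open>\<integral>\<^sub>a\<^sup>b w\<close>, because the velocity is linear in the control.
\<close>

lemma norm_velocity_integral_nearly_constant_le:
  assumes w: "w \<in> L2_controls" and y: "continuous_on {0..1} y" and sub: "{a..b} \<subseteq> {0..1}"
    and osc: "\<And>s. s \<in> {a..b} \<Longrightarrow> norm (y s - c) \<le> \<omega>"
  shows "norm (integral {a..b} (\<lambda>s. velocity (w s) (y s)))
    \<le> C * norm (integral {a..b} w) + C * \<omega> * integral {a..b} (\<lambda>s. norm (w s))"
proof -
  have lin: "bounded_linear (\<lambda>v. velocity v c)"
    unfolding velocity_def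
    by (intro bounded_linear_sum bounded_linear_scaleR_const[OF bounded_linear_vec_nth])
  have w_int: "w integrable_on {a..b}" "(\<lambda>s. norm (w s)) integrable_on {a..b}"
    by (rule L2_controls_integrable_subinterval[OF w sub])+
  have const_int: "((\<lambda>s. velocity (w s) c) has_integral velocity (integral {a..b} w) c) {a..b}"
    using has_integral_linear[OF integrable_integral[OF w_int(1)] lin] by (simp add: o_def)
  have y_int: "(\<lambda>s. velocity (w s) (y s)) integrable_on {a..b}"
    by (rule velocity_integrable[OF w y sub])
  have "integral {a..b} (\<lambda>s. velocity (w s) (y s)) = velocity (integral {a..b} w) c
      + integral {a..b} (\<lambda>s. velocity (w s) (y s) - velocity (w s) c)"
    using const_int y_int by (subst Henstock_Kurzweil_Integration.integral_diff) (auto simp: integral_unique)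
  also have "norm \<dots> \<le> C * norm (integral {a..b} w) + integral {a..b} (\<lambda>s. C * \<omega> * norm (w s))"
  proof (rule norm_triangle_mono[OF norm_velocity_le integral_norm_bound_integral])
    show "(\<lambda>s. velocity (w s) (y s) - velocity (w s) c) integrable_on {a..b}"
      using y_int const_int by (intro integrable_diff) auto
    show "(\<lambda>s. C * \<omega> * norm (w s)) integrable_on {a..b}" by (intro integrable_on_mult_right w_int)
    show "norm (velocity (w s) (y s) - velocity (w s) c) \<le> C * \<omega> * norm (w s)" if "s \<in> {a..b}" for s
    proof -
      have "norm (velocity (w s) (y s) - velocity (w s) c) \<le> C * norm (w s) * norm (y s - c)"
        by (rule norm_velocity_diff_le)
      also have "\<dots> \<le> C * norm (w s) * \<omega>"
        using osc[OF that] C_nonneg by (intro mult_left_mono) auto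
      finally show ?thesis by (simp add: mult_ac)
    qed
  qed
  finally show ?thesis by simp
qed

text \<open>
  The unit interval is cut into pieces on which \<open>y\<close> varies by at most \<open>\<omega>\<close>. The number of pieces is
  fixed before \<open>k\<close> tends to infinity, so the increments of the primitives over the pieces vanish
  in the limit, while the variation of \<open>y\<close> contributes at most \<open>C \<omega> M\<close>.
\<close>

lemma velocity_integral_weak_limit:
  assumes w: "\<And>k. w k \<in> L2_controls" and M: "\<And>k. L2_control_norm (w k) \<le> M"
    and lim: "uniform_limit {0..1} (\<lambda>k t. integral {0..t} (w k)) (\<lambda>_. 0) sequentially"
    and y: "continuous_on {0..1} y"
  shows "uniform_limit {0..1} (\<lambda>k t. integral {0..t} (\<lambda>s. velocity (w k s) (y s))) (\<lambda>_. 0) sequentially"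
  unfolding uniform_limit_sequentially_iff dist_norm
proof (intro allI impI)
  fix e :: real assume e: "e > 0"
  have M0: "M \<ge> 0" using M[of 0] L2_control_norm_nonneg[of "w 0"] by linarith
  \<comment> \<open>Half of the tolerance is reserved for the variation of \<open>y\<close>, half for the primitives.\<close>
  define \<omega> where "\<omega> = e / (2 * (C * M + 1))"
  have CM: "C * M \<ge> 0" using M0 C_nonneg by simp
  have \<omega>: "\<omega> > 0" using e CM by (simp add: \<omega>_def)
  have "uniformly_continuous_on {0..1} y" by (rule compact_uniformly_continuous[OF y compact_Icc])
  then obtain \<delta> where \<delta>: "\<delta> > 0" "\<And>s t. \<lbrakk>s \<in> {0..1}; t \<in> {0..1}; \<bar>t - s\<bar> < \<delta>\<rbrakk> \<Longrightarrow> norm (y t - y s) < \<omega>"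
    unfolding uniformly_continuous_on_def dist_norm using \<omega> by (metis real_norm_def)
  obtain n where n: "1 / real (Suc n) < \<delta>" using \<delta>(1) by (metis nat_approx_posE)
  define m where "m = real (Suc n)"
  define h where "h = e / (4 * (m * C + 1))"
  have m: "m > 0" by (simp add: m_def)
  have mC: "m * C \<ge> 0" using m C_nonneg by simp
  have h: "h > 0" using e mC by (simp add: h_def)
  obtain k0 where k0: "\<And>k t. k \<ge> k0 \<Longrightarrow> t \<in> {0..1} \<Longrightarrow> norm (integral {0..t} (w k)) < h"
    using lim h unfolding uniform_limit_sequentially_iff dist_norm by (auto simp del: atLeastAtMost_iff) meson
  have "norm (integral {0..t} (\<lambda>s. velocity (w k s) (y s))) < e" if k: "k \<ge> k0" and t: "t \<in> {0..1}" for k t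
  proof -
    \<comment> \<open>Truncating the subdivision at \<open>t\<close> treats all \<open>t\<close> at once: the last points coincide with \<open>t\<close>.\<close>
    define p where "p j = min (real j / m) t" for j :: nat
    have p: "p j \<in> {0..1}" "p j \<le> p (Suc j)" "p (Suc j) - p j \<le> 1 / m" for j
    proof -
      have "real (Suc j) / m = real j / m + 1 / m" by (simp add: add_divide_distrib)
      moreover have "min a t \<in> {0..1} \<and> min a t \<le> min (a + b) t \<and> min (a + b) t - min a t \<le> b"
        if "a \<ge> 0" "b > 0" for a b
        using that t by (auto simp: min_def)
      from this[of "real j / m" "1 / m"] m
      have "min (real j / m) t \<in> {0..1} \<and> min (real j / m) t \<le> min (real j / m + 1 / m) t \<and>
          min (real j / m + 1 / m) t - min (real j / m) t \<le> 1 / m"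
        by simp
      ultimately show "p j \<in> {0..1}" "p j \<le> p (Suc j)" "p (Suc j) - p j \<le> 1 / m"
        unfolding p_def by metis+
    qed
    have sum_le: "norm (integral {0..p j} (\<lambda>s. velocity (w k s) (y s)))
      \<le> real j * (2 * C * h) + C * \<omega> * integral {0..p j} (\<lambda>s. norm (w k s))" for j
    proof (induction j)
      case 0
      have "p 0 = 0" using t m by (simp add: p_def)
      then show ?case by simp
    next
      case (Suc j)
      have sub: "{0..p (Suc j)} \<subseteq> {0..1}" "{p j..p (Suc j)} \<subseteq> {0..1}" using p by auto
      have le: "0 \<le> p j" "p j \<le> p (Suc j)" using p by auto
      note comb = Henstock_Kurzweil_Integration.integral_combine[OF le]
      have wcomb: "integral {0..p j} (w k) + integral {p j..p (Suc j)} (w k) = integral {0..p (Suc j)} (w k)"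
        by (rule comb[OF L2_controls_integrable_subinterval(1)[OF w sub(1)]])
      have "norm (integral {p j..p (Suc j)} (w k)) \<le> norm (integral {0..p (Suc j)} (w k)) + norm (integral {0..p j} (w k))"
        using norm_triangle_ineq4[of "integral {0..p (Suc j)} (w k)" "integral {0..p j} (w k)"] by (simp flip: wcomb)
      also have "\<dots> \<le> 2 * h" using k0[OF k p(1)[of j]] k0[OF k p(1)[of "Suc j"]] by simp
      finally have incr: "C * norm (integral {p j..p (Suc j)} (w k)) \<le> C * (2 * h)"
        by (intro mult_left_mono C_nonneg)
      have osc: "norm (y s - y (p j)) \<le> \<omega>" if s: "s \<in> {p j..p (Suc j)}" for s
      proof -
        have "\<bar>s - p j\<bar> \<le> 1 / m" using s p(3)[of j] by auto
        then have "\<bar>s - p j\<bar> < \<delta>" using n by (simp add: m_def)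
        then show ?thesis using \<delta>(2)[of "p j" s] p(1)[of j] s sub(2) by (intro less_imp_le) auto
      qed
      have "integral {0..p (Suc j)} (\<lambda>s. velocity (w k s) (y s)) =
        integral {0..p j} (\<lambda>s. velocity (w k s) (y s)) + integral {p j..p (Suc j)} (\<lambda>s. velocity (w k s) (y s))"
        by (rule comb[OF velocity_integrable[OF w y sub(1)], symmetric])
      also have "norm \<dots> \<le> (real j * (2 * C * h) + C * \<omega> * integral {0..p j} (\<lambda>s. norm (w k s)))
         + (C * norm (integral {p j..p (Suc j)} (w k)) + C * \<omega> * integral {p j..p (Suc j)} (\<lambda>s. norm (w k s)))"
        by (rule norm_triangle_mono[OF Suc.IH norm_velocity_integral_nearly_constant_le[OF w y sub(2) osc]])
      also have "\<dots> \<le> (real j * (2 * C * h) + C * \<omega> * integral {0..p j} (\<lambda>s. norm (w k s)))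
         + (C * (2 * h) + C * \<omega> * integral {p j..p (Suc j)} (\<lambda>s. norm (w k s)))"
        using incr by simp
      also have "\<dots> = real (Suc j) * (2 * C * h) + C * \<omega> * (integral {0..p j} (\<lambda>s. norm (w k s)) + integral {p j..p (Suc j)} (\<lambda>s. norm (w k s)))"
        by (simp add: algebra_simps)
      also have "integral {0..p j} (\<lambda>s. norm (w k s)) + integral {p j..p (Suc j)} (\<lambda>s. norm (w k s)) = integral {0..p (Suc j)} (\<lambda>s. norm (w k s))"
        by (rule comb[OF L2_controls_integrable_subinterval(2)[OF w sub(1)]])
      finally show ?case .
    qed
    have "real (Suc n) / m = 1" unfolding m_def by simp
    then have pt: "p (Suc n) = t" unfolding p_def using t by simp
    have "integral {0..t} (\<lambda>s. norm (w k s)) \<le> L2_control_norm (w k) * sqrt (t - 0)"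
      using t by (intro L2_controls_interval_integral_le w) auto
    also have "\<dots> \<le> M * 1" using t M0 by (intro mult_mono M) auto
    finally have L1: "integral {0..t} (\<lambda>s. norm (w k s)) \<le> M" by simp
    have "norm (integral {0..t} (\<lambda>s. velocity (w k s) (y s)))
      \<le> m * (2 * C * h) + C * \<omega> * integral {0..t} (\<lambda>s. norm (w k s))"
      using sum_le[of "Suc n"] unfolding pt m_def by simp
    also have "\<dots> \<le> m * (2 * C * h) + C * \<omega> * M"
      using L1 \<omega> C_nonneg by (intro add_left_mono mult_left_mono) auto
    also have "m * (2 * C * h) < e / 2"
      using e mC by (simp add: h_def field_simps)
    also have "C * \<omega> * M < e / 2"
      using e CM by (simp add: \<omega>_def field_simps)
    finally show ?thesis by simp
  qed
  then show "\<exists>N. \<forall>k\<ge>N. \<forall>t\<in>{0..1}. norm (integral {0..t} (\<lambda>s. velocity (w k s) (y s)) - 0) < e"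
    by (intro exI[of _ k0]) auto
qed

end

section \<open>Controls of a convergent sequence of flows\<close>

text \<open>
  The first derivatives in the directions of a basis are bounded, so the operator norms of the
  derivative are bounded, and the mean value inequality applies.
\<close>

lemma smooth_bounded_imp_bounded_lipschitz:
  fixes f :: "'a::euclidean_space \<Rightarrow> 'b::euclidean_space"
  assumes f: "smooth_bounded f"
  obtains c where "c \<ge> 0" "\<And>x. norm (f x) \<le> c" "\<And>x y. norm (f x - f y) \<le> c * norm (x - y)"
proof -
  have "bounded (range (iter_deriv UNIV f vs))" for vs
    using f by (simp add: smooth_bounded_def)
  from this[of "[]"] this[of "[v]" for v] obtain c0
    where c0: "\<And>x. norm (f x) \<le> c0"
      and "\<And>v. bounded (range (\<lambda>x. frechet_derivative f (at x) v))"
    unfolding bounded_iff by auto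
  then have "\<forall>v. \<exists>c. \<forall>x. norm (frechet_derivative f (at x) v) \<le> c"
    unfolding bounded_iff by auto
  then obtain c1 where c1: "\<And>v x. norm (frechet_derivative f (at x) v) \<le> c1 v" by metis
  have diff: "f differentiable_on UNIV"
    using f unfolding smooth_bounded_def smooth_on_def by (metis iter_deriv.simps(1))
  then have der: "(f has_derivative frechet_derivative f (at x)) (at x)" for x
    by (simp add: differentiable_on_def frechet_derivative_works)
  define c2 where "c2 = (\<Sum>b\<in>Basis. c1 (b :: 'a))"
  have c1_nonneg: "c1 v \<ge> 0" for v by (rule order_trans[OF norm_ge_zero c1])
  have onorm: "onorm (frechet_derivative f (at x)) \<le> c2" for x
  proof (rule onorm_le)
    fix v :: 'a
    interpret D: bounded_linear "frechet_derivative f (at x)"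
      by (rule has_derivative_bounded_linear[OF der])
    have "frechet_derivative f (at x) v = (\<Sum>b\<in>Basis. (v \<bullet> b) *\<^sub>R frechet_derivative f (at x) b)"
      by (subst euclidean_representation[of v, symmetric]) (simp add: D.sum D.scaleR)
    also have "norm \<dots> \<le> (\<Sum>b\<in>Basis. norm v * c1 b)"
      by (rule sum_norm_le) (auto intro!: mult_mono c1 Basis_le_norm)
    also have "\<dots> = c2 * norm v" by (simp add: c2_def sum_distrib_left mult.commute)
    finally show "norm (frechet_derivative f (at x) v) \<le> c2 * norm v" .
  qed
  have lip: "norm (f x - f y) \<le> c2 * norm (x - y)" for x y
    by (rule differentiable_bound[of UNIV f "\<lambda>x. frechet_derivative f (at x)"]) (auto intro: der onorm)
  have "c0 \<ge> 0" by (rule order_trans[OF norm_ge_zero c0])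
  moreover have "c2 \<ge> 0" unfolding c2_def by (intro sum_nonneg c1_nonneg)
  ultimately show thesis
  proof (intro that[of "c0 + c2"])
    show "norm (f x) \<le> c0 + c2" for x using c0[of x] \<open>c2 \<ge> 0\<close> by simp
    show "norm (f x - f y) \<le> (c0 + c2) * norm (x - y)" for x y
      by (rule order_trans[OF lip]) (intro mult_right_mono, use \<open>c0 \<ge> 0\<close> in auto)
  qed simp
qed

lemma smooth_bounded_imp_control_system:
  fixes F :: "'l::finite \<Rightarrow> real^'n \<Rightarrow> real^'n"
  assumes F: "\<And>i. smooth_bounded (F i)"
  shows "\<exists>C. control_system F C"
proof -
  have "\<exists>c\<ge>0. (\<forall>x. norm (F i x) \<le> c) \<and> (\<forall>x y. norm (F i x - F i y) \<le> c * norm (x - y))" for i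
    using smooth_bounded_imp_bounded_lipschitz[OF F[of i]] by metis
  then obtain c where c: "\<And>i. c i \<ge> 0" "\<And>i x. norm (F i x) \<le> c i"
    "\<And>i x y. norm (F i x - F i y) \<le> c i * norm (x - y)" by metis
  have "control_system F (\<Sum>i\<in>UNIV. c i)"
  proof
    show "(\<Sum>i\<in>UNIV. c i) \<ge> 0" by (intro sum_nonneg c)
    show "continuous_on UNIV (F i)" for i
    proof -
      have "(c i)-lipschitz_on UNIV (F i)"
        using c by (intro lipschitz_onI) (auto simp: dist_norm)
      then show ?thesis by (rule lipschitz_on_continuous_on)
    qed
    show "norm (\<Sum>i\<in>UNIV. v $ i *\<^sub>R F i y) \<le> (\<Sum>i\<in>UNIV. c i) * norm v" for v :: "real^'l" and y
    proof -
      have "norm (\<Sum>i\<in>UNIV. v $ i *\<^sub>R F i y) \<le> (\<Sum>i\<in>UNIV. norm v * c i)"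
        by (rule sum_norm_le) (auto intro!: mult_mono c component_le_norm_cart)
      then show ?thesis by (simp add: sum_distrib_left mult.commute)
    qed
    show "norm ((\<Sum>i\<in>UNIV. v $ i *\<^sub>R F i y) - (\<Sum>i\<in>UNIV. v $ i *\<^sub>R F i z)) \<le> (\<Sum>i\<in>UNIV. c i) * norm v * norm (y - z)"
      for v :: "real^'l" and y z
    proof -
      have "norm ((\<Sum>i\<in>UNIV. v $ i *\<^sub>R F i y) - (\<Sum>i\<in>UNIV. v $ i *\<^sub>R F i z)) = norm (\<Sum>i\<in>UNIV. v $ i *\<^sub>R (F i y - F i z))"
        by (simp add: scaleR_diff_right sum_subtractf)
      also have "\<dots> \<le> (\<Sum>i\<in>UNIV. norm v * (c i * norm (y - z)))"
        by (rule sum_norm_le) (auto intro!: mult_mono c component_le_norm_cart)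
      also have "\<dots> = (\<Sum>i\<in>UNIV. c i) * norm v * norm (y - z)"
        by (simp add: sum_distrib_left sum_distrib_right mult_ac)
      finally show ?thesis .
    qed
  qed
  then show ?thesis ..
qed

context control_system
begin

lemma flow_weakly_continuous:
  assumes u: "\<And>k. u k \<in> L2_controls" and M: "\<And>k. L2_control_norm (u k) \<le> M" and v: "v \<in> L2_controls"
    and lim: "uniform_limit {0..1} (\<lambda>k t. integral {0..t} (u k)) (\<lambda>t. integral {0..t} v) sequentially"
  shows "(\<lambda>k. flow F (u k) x0) \<longlonglongrightarrow> flow F v x0"
proof -
  obtain y where y: "integral_solution v x0 y" using integral_solution_exists[OF v] by blast
  have yc: "continuous_on {0..1} y" using y by (simp add: integral_solution_def)
  have "\<exists>x. \<forall>k. integral_solution (u k) x0 (x k)"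
    by (intro choice allI integral_solution_exists u)
  then obtain x where x: "\<And>k. integral_solution (u k) x0 (x k)" by blast
  have diff: "(\<lambda>s. u k s - v s) \<in> L2_controls" for k by (rule L2_controls_diff[OF u v])
  have bound: "L2_control_norm (\<lambda>s. u k s - v s) \<le> sqrt (2 * M\<^sup>2 + 2 * (L2_control_norm v)\<^sup>2)" for k
  proof (rule real_le_rsqrt)
    have "(L2_control_norm (u k))\<^sup>2 \<le> M\<^sup>2" by (intro power_mono M L2_control_norm_nonneg)
    then show "(L2_control_norm (\<lambda>s. u k s - v s))\<^sup>2 \<le> 2 * M\<^sup>2 + 2 * (L2_control_norm v)\<^sup>2"
      using L2_control_parallelogram[OF u[of k] v]
        zero_le_power2[of "L2_control_norm (\<lambda>s. (1/2) *\<^sub>R u k s + (1/2) *\<^sub>R v s)"] by linarith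
  qed
  have "uniform_limit {0..1} (\<lambda>k t. integral {0..t} (\<lambda>s. u k s - v s)) (\<lambda>_. 0) sequentially"
  proof -
    have "uniform_limit {0..1} (\<lambda>k t. integral {0..t} (u k) - integral {0..t} v) (\<lambda>t. integral {0..t} v - integral {0..t} v) sequentially"
      by (intro uniform_limit_intros lim)
    moreover have "integral {0..t} (\<lambda>s. u k s - v s) = integral {0..t} (u k) - integral {0..t} v" if "t \<in> {0..1}" for k t
      using that by (intro Henstock_Kurzweil_Integration.integral_diff L2_controls_integrable_subinterval u v) auto
    ultimately show ?thesis unfolding uniform_limit_iff by simp
  qed
  from velocity_integral_weak_limit[OF diff bound this yc]
  have weak: "uniform_limit {0..1} (\<lambda>k t. integral {0..t} (\<lambda>s. velocity (u k s - v s) (y s))) (\<lambda>_. 0) sequentially" .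
  have "(\<lambda>k. x k 1) \<longlonglongrightarrow> y 1"
  proof (rule LIMSEQ_I)
    fix e :: real assume e: "e > 0"
    define b where "b = 2 * exp (2 * (C * M)\<^sup>2 + 1)"
    have b: "b > 0" by (simp add: b_def)
    then have "e / (2 * b) > 0" using e by simp
    then obtain N where N: "\<And>k t. k \<ge> N \<Longrightarrow> t \<in> {0..1} \<Longrightarrow> norm (integral {0..t} (\<lambda>s. velocity (u k s - v s) (y s))) < e / (2 * b)"
      using weak unfolding uniform_limit_sequentially_iff dist_norm diff_0_right by meson
    have "norm (x k 1 - y 1) < e" if "k \<ge> N" for k
    proof -
      have "norm (x k 1 - y 1) \<le> 2 * (e / (2 * b)) * exp (2 * (C * M)\<^sup>2 + 1)"
        by (rule integral_solution_stable[OF u v M x y]) (use N[OF that] in \<open>auto intro: less_imp_le\<close>)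
      also have "\<dots> = e / (2 * b) * b" by (simp add: b_def)
      also have "\<dots> < e" using b e by simp
      finally show ?thesis .
    qed
    then show "\<exists>N. \<forall>k\<ge>N. norm (x k 1 - y 1) < e" by blast
  qed
  then show ?thesis
    by (simp add: flow_eq_integral_solution[OF u x] flow_eq_integral_solution[OF v y])
qed

end

theorem proposition4p1:
  fixes F :: "'l::finite \<Rightarrow> real^'n \<Rightarrow> real^'n"
    and K :: "(real^'n) set"
    and \<Psi> :: "real^'n \<Rightarrow> real^'n"
    and u :: "nat \<Rightarrow> real \<Rightarrow> real^'l"
  assumes "\<And>i. smooth_bounded (F i)"
    and "compact K"
    and "\<Psi> \<in> Diff0_on K - flows_on K F"
    and "\<And>k. u k \<in> L2_controls"
    and "uniform_limit K (\<lambda>k. restrict (flow F (u k)) K) \<Psi> sequentially"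
  shows "\<not> bdd_above (range (\<lambda>k. L2_control_norm (u k)))"
proof
  assume "bdd_above (range (\<lambda>k. L2_control_norm (u k)))"
  then obtain M where M: "\<And>k. L2_control_norm (u k) \<le> M"
    unfolding bdd_above_def by auto
  obtain C where "control_system F C"
    using smooth_bounded_imp_control_system[of F] assms(1) by blast
  then interpret control_system F C .
  obtain v r where v: "v \<in> L2_controls" and r: "strict_mono (r :: nat \<Rightarrow> nat)"
    and lim: "uniform_limit {0..1} (\<lambda>k t. integral {0..t} (u (r k))) (\<lambda>t. integral {0..t} v) sequentially"
    by (rule L2_bounded_controls_weakly_compact[OF assms(4) M], rule that)
  have eq: "\<Psi> x = flow F v x" if x: "x \<in> K" for x
  proof (rule LIMSEQ_unique)
    have "(\<lambda>k. flow F (u k) x) \<longlonglongrightarrow> \<Psi> x"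
      using tendsto_uniform_limitI[OF assms(5) x] x by simp
    then show "(\<lambda>k. flow F (u (r k)) x) \<longlonglongrightarrow> \<Psi> x"
      using LIMSEQ_subseq_LIMSEQ[OF _ r] by (simp add: o_def)
    show "(\<lambda>k. flow F (u (r k)) x) \<longlonglongrightarrow> flow F v x"
      by (rule flow_weakly_continuous[OF assms(4) M v lim])
  qed
  moreover have "\<Psi> \<in> extensional K" using assms(3) by (auto simp: Diff0_on_def)
  ultimately have "\<Psi> = restrict (flow F v) K"
    by (intro extensionalityI[of _ K]) auto
  then have "\<Psi> \<in> flows_on K F" using v by (auto simp: flows_on_def)
  then show False using assms(3) by blast
qed

end
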